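(* Let $K$ be a field and let ${\bf n}=(n_1,n_2,n_3,n_4)$ be a sequence of positive integers with $\gcd(n_1,n_2,n_3,n_4)=1$. For each $i$ let $a_i$ be the least positive integer such that $a_i n_i\in\sum_{j\neq i}\mathbb{N}n_j$. Let $I({\bf n})$ be a complete intersection ideal generated by the binomials $f_1=x_1^{a_1}-x_2^{a_2}$, $f_2=x_3^{a_3}-x_4^{a_4}$ and $f_3=x_1^{u_1}x_2^{u_2}-x_3^{u_3}x_4^{u_4}$, where $u_1,\ldots,u_4\in\mathbb{N}$, and suppose that $n_1=\min\{n_1,n_2,n_3,n_4\}$ and $a_3<a_4$. Consider the vector ${\bf d}=(a_2a_3,\,a_1a_3,\,a_2a_4,\,a_2a_3)$. If $C({\bf n})$ has Cohen-Macaulay tangent cone at the origin, then for every integer $w>0$ the monomial curve $C({\bf n}+w{\bf d})$ has Cohen-Macaulay tangent cone at the origin whenever the entries of ${\bf n}+w{\bf d}$ are relatively prime.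
   Context: $\mathbb{N}$ is the set of non-negative integers. For a sequence ${\bf m}=(m_1,\ldots,m_4)$ of positive integers with $\gcd(m_1,\ldots,m_4)=1$, $I({\bf m})$ is the toric ideal, i.e. the kernel of the $K$-algebra homomorphism $K[x_1,\ldots,x_4]\to K[t]$, $x_i\mapsto t^{m_i}$; it has height $3$ and is the defining ideal of the monomial curve $C({\bf m})$ parametrized by $x_i=t^{m_i}$. $I({\bf m})$ is a complete intersection if it can be generated by $3$ elements. For a nonzero polynomial $f$, $f_*$ denotes the homogeneous summand of $f$ of least degree, and $I({\bf m})_*$ is the ideal generated by all $f_*$ with $f\in I({\bf m})$, $f\neq 0$. $C({\bf m})$ has Cohen-Macaulay tangent cone at the origin if the ring $K[x_1,\ldots,x_4]/I({\bf m})_*$ is Cohen-Macaulay. "The entries are relatively prime" means that the greatest common divisor of all four entries is $1$. *)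

theory Defs
  imports
    "HOL-Algebra.Ring_Divisibility"
    "HOL-Computational_Algebra.Polynomial"
    "HOL-Library.Poly_Mapping"
    "HOL-Library.Numeral_Type"
    "HOL-Library.Extended_Nat"
begin

section \<open>Cohen--Macaulay rings\<close>

definition regular_sequence :: "('a, 'b) ring_scheme \<Rightarrow> 'a list \<Rightarrow> bool" where
  "regular_sequence R xs \<longleftrightarrow>
     set xs \<subseteq> carrier R \<and>
     Idl\<^bsub>R\<^esub> (set xs) \<noteq> carrier R \<and>
     (\<forall>i < length xs. \<forall>y \<in> carrier R.
        xs ! i \<otimes>\<^bsub>R\<^esub> y \<in> Idl\<^bsub>R\<^esub> (set (take i xs)) \<longrightarrow> y \<in> Idl\<^bsub>R\<^esub> (set (take i xs)))"

definition ideal_depth :: "('a, 'b) ring_scheme \<Rightarrow> 'a set \<Rightarrow> enat" where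
  "ideal_depth R P = (SUP xs \<in> {xs. regular_sequence R xs \<and> set xs \<subseteq> P}. enat (length xs))"

text \<open>The list \<open>ps\<close> is a chain \<open>P\<^sub>0 \<subset> \<dots> \<subset> P\<^sub>h = P\<close> of prime ideals.\<close>

definition prime_height :: "('a, 'b) ring_scheme \<Rightarrow> 'a set \<Rightarrow> enat" where
  "prime_height R P =
     (SUP ps \<in> {ps. ps \<noteq> [] \<and> last ps = P \<and> (\<forall>Q \<in> set ps. primeideal Q R) \<and> sorted_wrt (\<subset>) ps}.
        enat (length ps - 1))"

text \<open>
  This is the definition of Eisenbud (Commutative Algebra with a View Toward Algebraic Geometry,
  Section 18.2): a Noetherian ring is Cohen--Macaulay if every maximal ideal \<open>P\<close> has depth equal
  to its codimension. It is the usual condition on the local rings, because over a Noetherian ring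
  \<open>depth(P, R) = depth R\<^sub>P\<close> for maximal \<open>P\<close>, and the height of \<open>P\<close> is the dimension of \<open>R\<^sub>P\<close>.
\<close>

definition cohen_macaulay :: "('a, 'b) ring_scheme \<Rightarrow> bool" where
  "cohen_macaulay R \<longleftrightarrow>
     cring R \<and> noetherian_ring R \<and>
     (\<forall>P. maximalideal P R \<longrightarrow> ideal_depth R P = prime_height R P)"

section \<open>Polynomials in the variables \<open>x\<^sub>i\<close>, where \<open>i\<close> ranges over a finite type\<close>

text \<open>A polynomial maps each exponent vector to its coefficient.\<close>

type_synonym ('v, 'k) mpoly = "('v \<Rightarrow>\<^sub>0 nat) \<Rightarrow>\<^sub>0 'k"

definition mpoly_ring :: "('v, 'k :: comm_ring_1) mpoly ring" where
  "mpoly_ring = \<lparr>carrier = UNIV, mult = (*), one = 1, zero = 0, add = (+)\<rparr>"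

lemma cring_mpoly_ring: "cring (mpoly_ring :: ('v, 'k :: comm_ring_1) mpoly ring)"
proof (rule cringI)
  show "abelian_group (mpoly_ring :: ('v, 'k) mpoly ring)"
  proof (rule abelian_groupI)
    fix x :: "('v, 'k) mpoly"
    have "(- x) \<oplus>\<^bsub>mpoly_ring\<^esub> x = \<zero>\<^bsub>mpoly_ring\<^esub>" by (simp add: mpoly_ring_def)
    then show "\<exists>y \<in> carrier mpoly_ring. y \<oplus>\<^bsub>mpoly_ring\<^esub> x = \<zero>\<^bsub>mpoly_ring\<^esub>"
      by (intro bexI[of _ "- x"]) (simp_all add: mpoly_ring_def)
  qed (simp_all add: mpoly_ring_def algebra_simps)
  show "comm_monoid (mpoly_ring :: ('v, 'k) mpoly ring)"
    by (rule comm_monoidI) (simp_all add: mpoly_ring_def algebra_simps)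
qed (simp add: mpoly_ring_def algebra_simps)

definition var :: "'v \<Rightarrow> ('v, 'k :: comm_ring_1) mpoly" where
  "var i = Poly_Mapping.single (Poly_Mapping.single i 1) 1"

definition total_degree :: "('v :: finite \<Rightarrow>\<^sub>0 nat) \<Rightarrow> nat" where
  "total_degree m = (\<Sum>i\<in>UNIV. Poly_Mapping.lookup m i)"

definition homogeneous_component :: "nat \<Rightarrow> ('v :: finite, 'k :: comm_ring_1) mpoly \<Rightarrow> ('v, 'k) mpoly" where
  "homogeneous_component e p =
     (\<Sum>m \<in> {m \<in> Poly_Mapping.keys p. total_degree m = e}. Poly_Mapping.single m (Poly_Mapping.lookup p m))"

text \<open>\<open>f\<^sub>*\<close>, for nonzero \<open>f\<close>\<close>

definition initial_form :: "('v :: finite, 'k :: comm_ring_1) mpoly \<Rightarrow> ('v, 'k) mpoly" where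
  "initial_form p = homogeneous_component (LEAST e. homogeneous_component e p \<noteq> 0) p"

definition initial_form_ideal :: "('v :: finite, 'k :: comm_ring_1) mpoly set \<Rightarrow> ('v, 'k) mpoly set" where
  "initial_form_ideal I = Idl\<^bsub>mpoly_ring\<^esub> {initial_form f | f. f \<in> I \<and> f \<noteq> 0}"

section \<open>Monomial curves\<close>

text \<open>The \<open>K\<close>-algebra homomorphism \<open>K[x] \<rightarrow> K[t]\<close> with \<open>x\<^sub>i \<mapsto> t ^ n i\<close>\<close>

definition curve_map :: "('v :: finite \<Rightarrow> nat) \<Rightarrow> ('v, 'k :: field) mpoly \<Rightarrow> 'k poly" where
  "curve_map n p =
     (\<Sum>m \<in> Poly_Mapping.keys p. Polynomial.smult (Poly_Mapping.lookup p m) (\<Prod>i\<in>UNIV. Polynomial.monom 1 (n i) ^ Poly_Mapping.lookup m i))"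

lemma curve_map_superset:
  assumes "finite A" "Poly_Mapping.keys p \<subseteq> A"
  shows "curve_map n p =
    (\<Sum>m \<in> A. Polynomial.smult (Poly_Mapping.lookup p m) (\<Prod>i\<in>UNIV. Polynomial.monom 1 (n i) ^ Poly_Mapping.lookup m i))"
  unfolding curve_map_def using assms by (intro sum.mono_neutral_left) (auto simp: in_keys_iff)

lemma curve_map_single:
  "curve_map n (Poly_Mapping.single m c) =
     Polynomial.smult c (\<Prod>i\<in>UNIV. Polynomial.monom 1 (n i) ^ Poly_Mapping.lookup m i)"
  by (subst curve_map_superset[of "{m}"]) auto

lemma curve_map_const: "curve_map n (Poly_Mapping.single 0 c) = [:c:]"
  by (simp add: curve_map_single)

lemma curve_map_one: "curve_map n 1 = 1"
  by (metis curve_map_const single_one pCons_one)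

lemma curve_map_var:
  "curve_map n (var i :: ('v :: finite, 'k :: field) mpoly) = Polynomial.monom 1 (n i)"
proof -
  have "(\<Prod>j\<in>UNIV. Polynomial.monom 1 (n j) ^ Poly_Mapping.lookup (Poly_Mapping.single i (1 :: nat)) j) =
        (\<Prod>j\<in>UNIV. if j = i then Polynomial.monom (1 :: 'k) (n i) else 1)"
    by (rule prod.cong) (auto simp: lookup_single when_def)
  then show ?thesis by (simp add: var_def curve_map_single)
qed

lemma curve_map_add: "curve_map n (p + q) = curve_map n p + curve_map n q"
  using keys_add[of p q]
  by (simp add: curve_map_superset[of "Poly_Mapping.keys p \<union> Poly_Mapping.keys q"] lookup_add smult_add_left sum.distrib)

lemma curve_map_sum: "curve_map n (sum f A) = (\<Sum>x\<in>A. curve_map n (f x))"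
  by (induction A rule: infinite_finite_induct) (simp_all add: curve_map_add, simp_all add: curve_map_def)

lemma curve_map_mult:
  fixes p q :: "('v :: finite, 'k :: field) mpoly"
  shows "curve_map n (p * q) = curve_map n p * curve_map n q"
proof -
  have expand: "r = (\<Sum>m \<in> Poly_Mapping.keys r. Poly_Mapping.single m (Poly_Mapping.lookup r m))" for r :: "('v, 'k) mpoly"
    by (rule poly_mapping_eqI) (simp add: lookup_sum lookup_single when_def in_keys_iff)
  have single: "curve_map n (Poly_Mapping.single m c * Poly_Mapping.single m' c') =
      curve_map n (Poly_Mapping.single m c) * curve_map n (Poly_Mapping.single m' c')"
    for m m' :: "'v \<Rightarrow>\<^sub>0 nat" and c c' :: 'k
    by (simp add: mult_single curve_map_single lookup_add power_add prod.distrib mult.commute)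
  show ?thesis
    by (subst expand[of p], subst expand[of q], subst (3) expand[of p], subst (3) expand[of q])
       (simp only: sum_product curve_map_sum single)
qed

definition toric_ideal :: "('v :: finite \<Rightarrow> nat) \<Rightarrow> ('v, 'k :: field) mpoly set" where
  "toric_ideal n = {p. curve_map n p = 0}"

text \<open>
  For positive weights on four variables with greatest common divisor 1, the toric ideal has
  height 3.
\<close>

definition complete_intersection :: "(4, 'k :: field) mpoly set \<Rightarrow> bool" where
  "complete_intersection I \<longleftrightarrow> (\<exists>f g h. I = Idl\<^bsub>mpoly_ring\<^esub> {f, g, h})"

text \<open>The field \<open>K\<close> is passed as a type argument.\<close>

definition cm_tangent_cone :: "'k :: field itself \<Rightarrow> ('v :: finite \<Rightarrow> nat) \<Rightarrow> bool" where
  "cm_tangent_cone K n \<longleftrightarrow>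
     cohen_macaulay (mpoly_ring Quot initial_form_ideal (toric_ideal n :: ('v, 'k) mpoly set))"

text \<open>The least positive \<open>b\<close> such that \<open>b n\<^sub>i\<close> is an \<open>\<nat>\<close>-combination of the other \<open>n\<^sub>j\<close>\<close>

definition least_multiple :: "('v :: finite \<Rightarrow> nat) \<Rightarrow> 'v \<Rightarrow> nat" where
  "least_multiple n i = (LEAST b. b > 0 \<and> (\<exists>c :: 'v \<Rightarrow> nat. b * n i = (\<Sum>j \<in> UNIV - {i}. c j * n j)))"

text \<open>
  Variables are indexed by the type \<^typ>\<open>4\<close> of integers modulo 4, in which the numeral 4 denotes
  the element 0.
\<close>

lemma UNIV_4: "(UNIV :: 4 set) = {1, 2, 3, 4}"
proof -
  have "card {1, 2, 3, 4 :: 4} = card (UNIV :: 4 set)" by simp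
  then show ?thesis by (metis card_eq_UNIV_imp_eq_UNIV finite)
qed

end

theory Submission
  imports Defs
begin

text \<open>
  Let \<open>n\<^sub>1\<close> be the least weight. The graded ring \<open>R = K[x] / I(n)\<^sub>*\<close> has a \<open>K\<close>-basis indexed by the
  elements of the numerical semigroup: the class of a monomial depends only on its weight, and it
  is zero iff another monomial of the same weight has a larger degree. Since \<open>x\<^sub>i ^ n\<^sub>1 - x\<^sub>1 ^ n\<^sub>i\<close>
  lies in \<open>I(n)\<close>, the ring \<open>R\<close> is \<open>K[x\<^sub>1]\<close> plus nilpotents, so its prime ideals are those of a line,
  and \<open>R\<close> is Cohen--Macaulay iff \<open>x\<^sub>1\<close> is a nonzerodivisor, that is, iff multiplication by \<open>x\<^sub>1\<close>
  preserves the monomials of maximal degree in their weight.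

  The form of the generators gives \<open>n = (a\<^sub>2 p, a\<^sub>1 p, a\<^sub>4 q, a\<^sub>3 q)\<close> with \<open>p = a\<^sub>4 u\<^sub>3 + a\<^sub>3 u\<^sub>4\<close>
  and \<open>q = a\<^sub>2 u\<^sub>1 + a\<^sub>1 u\<^sub>2\<close>, where one may take \<open>u\<^sub>2 < a\<^sub>2\<close> and \<open>u\<^sub>3 < a\<^sub>3\<close>. The criterion then becomes
  \<open>u\<^sub>3 + u\<^sub>4 \<le> u\<^sub>1 + u\<^sub>2\<close> and, if \<open>u\<^sub>3 > 0\<close>, also \<open>a\<^sub>4 + u\<^sub>4 \<le> u\<^sub>1 + u\<^sub>2 + a\<^sub>3 - u\<^sub>3\<close>. Passing from \<open>n\<close> to
  \<open>n + w d\<close> replaces \<open>u\<^sub>1, u\<^sub>4\<close> by \<open>u\<^sub>1 + w, u\<^sub>4 + w\<close>, which leaves both inequalities unchanged.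
\<close>

section \<open>Rings that are a line plus nilpotents\<close>

context cring
begin

lemma idealI_cring:
  assumes "I \<subseteq> carrier R" "\<zero> \<in> I" "\<And>a b. a \<in> I \<Longrightarrow> b \<in> I \<Longrightarrow> a \<oplus> b \<in> I"
    and "\<And>a x. a \<in> I \<Longrightarrow> x \<in> carrier R \<Longrightarrow> x \<otimes> a \<in> I"
  shows "ideal I R"
proof (rule idealI)
  show "ring R" by (rule ring_axioms)
  show "subgroup I (add_monoid R)"
  proof (rule add.subgroupI)
    show "I \<subseteq> carrier R" "I \<noteq> {}" using assms by auto
  next
    fix a assume a: "a \<in> I"
    then have "\<ominus> a = \<ominus> \<one> \<otimes> a" using assms(1) by (auto simp: l_minus)
    then show "\<ominus> a \<in> I" using assms(4)[OF a, of "\<ominus> \<one>"] by simp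
  next
    fix a b assume "a \<in> I" "b \<in> I"
    then show "a \<oplus> b \<in> I" by (rule assms(3))
  qed
next
  fix a x assume a: "a \<in> I" "x \<in> carrier R"
  show "x \<otimes> a \<in> I" by (rule assms(4)[OF a])
  have "a \<otimes> x = x \<otimes> a" using a assms(1) by (auto intro: m_comm)
  then show "a \<otimes> x \<in> I" using assms(4)[OF a] by simp
qed

lemma ideal_minus: "ideal I R \<Longrightarrow> a \<in> I \<Longrightarrow> b \<in> I \<Longrightarrow> a \<ominus> b \<in> I"
  by (simp add: a_minus_def additive_subgroup.a_closed additive_subgroup.a_inv_closed ideal_def)

lemma ideal_diff_imp:
  assumes "ideal I R" "a \<in> carrier R" "a \<ominus> b \<in> I" "b \<in> I"
  shows "a \<in> I"
proof -
  have b: "b \<in> carrier R" using assms by (auto dest: additive_subgroup.a_Hcarr[OF ideal.axioms(1)])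
  have "a = (a \<ominus> b) \<oplus> b" using assms(2) b by algebra
  then show ?thesis using assms additive_subgroup.a_closed[OF ideal.axioms(1)] by metis
qed

lemma ideal_diff_commute:
  assumes "ideal I R" "a \<in> carrier R" "b \<in> carrier R" "a \<ominus> b \<in> I"
  shows "b \<ominus> a \<in> I"
proof -
  have "b \<ominus> a = \<ominus> (a \<ominus> b)" using assms(2,3) by algebra
  then show ?thesis using assms additive_subgroup.a_inv_closed[OF ideal.axioms(1)] by metis
qed

lemma pow_cong_ideal:
  assumes I: "ideal I R" and [simp]: "a \<in> carrier R" "b \<in> carrier R" and ab: "a \<ominus> b \<in> I"
  shows "a [^] (k::nat) \<ominus> b [^] k \<in> I"
proof (induction k)
  case 0
  then show ?case using additive_subgroup.zero_closed[OF ideal.axioms(1)[OF I]] by (simp add: a_minus_def r_neg)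
next
  case (Suc k)
  have c: "a [^] k \<in> carrier R" "b [^] k \<in> carrier R" by auto
  have "a [^] Suc k \<ominus> b [^] Suc k = a [^] k \<otimes> (a \<ominus> b) \<oplus> b \<otimes> (a [^] k \<ominus> b [^] k)"
    unfolding nat_pow_Suc using c assms(2,3) by algebra
  then show ?case
    using Suc ab c assms(2,3) additive_subgroup.a_closed[OF ideal.axioms(1)[OF I]] ideal.I_l_closed[OF I] by simp
qed

text \<open>For zero \<open>I\<close> this is the annihilator of \<open>z\<close>. That it is an
  ideal lets \<open>nil_pow\<close> exchange an element multiplying \<open>z\<close> into
  \<open>I\<close> for another one congruent to it modulo nilpotents.\<close>

lemma colon_ideal:
  assumes I: "ideal I R" and z: "z \<in> carrier R"
  shows "ideal {r \<in> carrier R. r \<otimes> z \<in> I} R"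
proof (rule idealI_cring)
  show "\<zero> \<in> {r \<in> carrier R. r \<otimes> z \<in> I}"
    using additive_subgroup.zero_closed[OF ideal.axioms(1)[OF I]] z by simp
qed (use z additive_subgroup.a_closed[OF ideal.axioms(1)[OF I]] ideal.I_l_closed[OF I]
      in \<open>auto simp: l_distr m_assoc\<close>)

lemma genideal_empty: "Idl {} = {\<zero>}"
  using genideal_minimal[OF zeroideal, of "{}"] additive_subgroup.zero_closed[OF ideal.axioms(1)[OF genideal_ideal[of "{}"]]]
  by auto

lemma regular_pow:
  assumes "\<And>z. z \<in> carrier R \<Longrightarrow> y \<otimes> z \<in> I \<Longrightarrow> z \<in> I" "y \<in> carrier R"
    and "z \<in> carrier R" "y [^] (k::nat) \<otimes> z \<in> I"
  shows "z \<in> I"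
  using assms(3,4)
proof (induction k arbitrary: z)
  case (Suc k)
  have "y [^] Suc k \<otimes> z = y [^] k \<otimes> (y \<otimes> z)" using assms(2) Suc.prems by (simp add: m_assoc)
  then show ?case using Suc assms(1,2) by (metis m_closed)
qed simp

end

section \<open>Primes and heights in rings whose reduction is K[t]\<close>

lemma poly_set_generator:
  fixes D :: "'k :: field poly set"
  assumes add: "\<And>g h. g \<in> D \<Longrightarrow> h \<in> D \<Longrightarrow> g + h \<in> D" and mult: "\<And>g h. g \<in> D \<Longrightarrow> h * g \<in> D"
    and ne: "\<exists>g \<in> D. g \<noteq> 0"
  obtains d where "d \<in> D" "d \<noteq> 0" "\<And>g. g \<in> D \<Longrightarrow> d dvd g"
proof -
  obtain d where d: "d \<in> D" "d \<noteq> 0" and min: "\<And>g. g \<in> D \<Longrightarrow> g \<noteq> 0 \<Longrightarrow> degree d \<le> degree g"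
    using ex_has_least_nat[of "\<lambda>g. g \<in> D \<and> g \<noteq> 0" _ degree] ne by (metis (no_types, lifting))
  \<comment> \<open>The remainder modulo an element of least degree stays in \<open>D\<close>, so it
    must vanish.\<close>
  have "d dvd g" if g: "g \<in> D" for g
  proof (rule ccontr)
    assume "\<not> d dvd g"
    then have r: "g mod d \<noteq> 0" by (simp add: mod_eq_0_iff_dvd)
    have "g mod d = g + (- (g div d)) * d" by (simp add: minus_div_mult_eq_mod[symmetric])
    then have "g mod d \<in> D" using add mult g d(1) by metis
    then show False using min[OF _ r] degree_mod_less'[OF d(2) r] by simp
  qed
  then show ?thesis using that d by blast
qed

text \<open>The axioms make \<open>s\<close> a ring homomorphism from K[t] that induces an
  isomorphism onto R/Q: \<open>s_Q\<close> gives injectivity, \<open>decomp\<close> surjectivity. As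
  \<open>Q\<close> is nil, R has the prime ideals of the affine line.\<close>

locale line_plus_nil = cring R for R (structure) +
  fixes s :: "'k :: field poly \<Rightarrow> 'a" and Q
  assumes s_closed [simp, intro]: "s g \<in> carrier R"
    and s_add: "s (g + h) = s g \<oplus> s h"
    and s_mult: "s (g * h) = s g \<otimes> s h"
    and s_one: "s 1 = \<one>"
    and Q_ideal: "ideal Q R"
    and Q_nil: "\<nu> \<in> Q \<Longrightarrow> \<exists>k::nat. \<nu> [^] k = \<zero>"
    and s_Q: "s g \<in> Q \<Longrightarrow> g = 0"
    and decomp: "r \<in> carrier R \<Longrightarrow> \<exists>g. r \<ominus> s g \<in> Q"
begin

lemma s_zero [simp]: "s 0 = \<zero>"
  using s_add[of 0 0] by (metis add.r_cancel_one' add_0 s_closed)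

lemma s_minus: "s (g - h) = s g \<ominus> s h"
proof -
  have "s (g - h) \<oplus> s h = s g" by (simp flip: s_add)
  moreover have "s (g - h) = (s (g - h) \<oplus> s h) \<ominus> s h"
    using s_closed[of "g - h"] s_closed[of h] by algebra
  ultimately show ?thesis by simp
qed

lemma s_pow: "s (g ^ k) = s g [^] k"
  by (induction k) (simp_all add: s_one s_mult m_comm)

lemma Q_sub: "q \<in> Q \<Longrightarrow> q \<in> carrier R"
  using additive_subgroup.a_Hcarr[OF ideal.axioms(1)[OF Q_ideal]] .

text \<open>Modulo \<open>I\<close> the element \<open>b\<close> agrees with the nilpotent
  \<open>b - a\<close>, so a power of \<open>b\<close> vanishes there. This moves facts between a
  ring element and its polynomial representative.\<close>

lemma nil_pow:
  assumes I: "ideal I R" and a: "a \<in> I" and b: "b \<in> carrier R" and ab: "b \<ominus> a \<in> Q"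
  shows "\<exists>k::nat. b [^] k \<in> I"
proof -
  have ac: "a \<in> carrier R" using I a by (auto dest: additive_subgroup.a_Hcarr[OF ideal.axioms(1)])
  let ?n = "b \<ominus> a"
  obtain k where k: "?n [^] (k::nat) = \<zero>" using Q_nil[OF ab] by blast
  have "b \<ominus> ?n = a" using ac b by algebra
  then have "b [^] k \<ominus> ?n [^] k \<in> I" using pow_cong_ideal[OF I b, of ?n] a ac b by simp
  then show ?thesis using k b by (auto simp: a_minus_def)
qed

lemma prime_Q_subset:
  assumes "primeideal P R" shows "Q \<subseteq> P"
proof
  interpret P: primeideal P R by fact
  fix q assume q: "q \<in> Q"
  obtain k where k: "q [^] (k::nat) = \<zero>" using Q_nil[OF q] by blast
  have "q [^] (k::nat) \<in> P \<Longrightarrow> q \<in> P" for k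
  proof (induction k)
    case 0
    then have "\<one> \<in> P" by simp
    then show ?case using P.one_imp_carrier P.I_notcarr by simp
  next
    case (Suc k)
    then show ?case using P.I_prime[of "q [^] k" q] Q_sub[OF q] by auto
  qed
  then show "q \<in> P" using k P.zero_closed by metis
qed

text \<open>An ideal above \<open>Q\<close> is determined by the polynomials whose images it
  contains.\<close>

lemma mem_iff_s:
  assumes "ideal I R" "Q \<subseteq> I" "r \<in> carrier R" "r \<ominus> s g \<in> Q"
  shows "r \<in> I \<longleftrightarrow> s g \<in> I"
  using assms ideal_diff_imp[OF assms(1), of r "s g"] ideal_diff_imp[OF assms(1), of "s g" r]
    ideal_diff_commute[OF Q_ideal, of r "s g"] by auto

text \<open>The quotient by \<open>Q\<close> is the integral domain K[t].\<close>

lemma prime_Q: "primeideal Q R"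
proof (rule primeidealI[OF Q_ideal is_cring])
  show "carrier R \<noteq> Q"
    using s_Q[of 1] s_closed[of 1] by auto
next
  fix a b assume c: "a \<in> carrier R" "b \<in> carrier R" and ab: "a \<otimes> b \<in> Q"
  obtain g h where g: "a \<ominus> s g \<in> Q" and h: "b \<ominus> s h \<in> Q" using decomp c by blast
  have "a \<otimes> b \<ominus> s (g * h) = b \<otimes> (a \<ominus> s g) \<oplus> s g \<otimes> (b \<ominus> s h)"
    unfolding s_mult using c s_closed[of g] s_closed[of h] by algebra
  also have "\<dots> \<in> Q" using g h c ideal.I_l_closed[OF Q_ideal]
    additive_subgroup.a_closed[OF ideal.axioms(1)[OF Q_ideal]] by simp
  finally have "s (g * h) \<in> Q"
    using ab mem_iff_s[OF Q_ideal, of "a \<otimes> b" "g * h"] c by simp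
  then have "g = 0 \<or> h = 0" using s_Q[of "g * h"] by auto
  then show "a \<in> Q \<or> b \<in> Q"
    using mem_iff_s[OF Q_ideal _ c(1) g] mem_iff_s[OF Q_ideal _ c(2) h]
      additive_subgroup.zero_closed[OF ideal.axioms(1)[OF Q_ideal]] by auto
qed

text \<open>The point t = 0 of the line: the preimage of the ideal (t) under the projection of R to
  K[t].\<close>

definition origin :: "'a set" where
  "origin = {r \<in> carrier R. \<exists>g. r \<ominus> s ([:0, 1:] * g) \<in> Q}"

lemma origin_ideal: "ideal origin R"
proof (rule idealI_cring)
  have "s ([:0, 1:] * 0) = \<zero>" by simp
  then have "\<zero> \<ominus> s ([:0, 1:] * 0) \<in> Q"
    using additive_subgroup.zero_closed[OF ideal.axioms(1)[OF Q_ideal]] by (simp add: a_minus_def)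
  then show "\<zero> \<in> origin" unfolding origin_def by blast
next
  fix a b assume "a \<in> origin" "b \<in> origin"
  then obtain g h where c: "a \<in> carrier R" "b \<in> carrier R"
    and g: "a \<ominus> s ([:0, 1:] * g) \<in> Q" and h: "b \<ominus> s ([:0, 1:] * h) \<in> Q" unfolding origin_def by blast
  have "(a \<oplus> b) \<ominus> s ([:0, 1:] * (g + h)) = (a \<ominus> s ([:0, 1:] * g)) \<oplus> (b \<ominus> s ([:0, 1:] * h))"
    unfolding distrib_left s_add using c s_closed[of "[:0, 1:] * g"] s_closed[of "[:0, 1:] * h"] by algebra
  then have "(a \<oplus> b) \<ominus> s ([:0, 1:] * (g + h)) \<in> Q"
    using g h additive_subgroup.a_closed[OF ideal.axioms(1)[OF Q_ideal]] by simp
  then show "a \<oplus> b \<in> origin" unfolding origin_def using c by blast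
next
  fix a x assume "a \<in> origin" and x: "x \<in> carrier R"
  then obtain g where c: "a \<in> carrier R" and g: "a \<ominus> s ([:0, 1:] * g) \<in> Q" unfolding origin_def by blast
  obtain h where h: "x \<ominus> s h \<in> Q" using decomp x by blast
  have "x \<otimes> a \<ominus> s ([:0, 1:] * (h * g)) = x \<otimes> (a \<ominus> s ([:0, 1:] * g)) \<oplus> s ([:0, 1:] * g) \<otimes> (x \<ominus> s h)"
  proof -
    have "s ([:0, 1:] * (h * g)) = s h \<otimes> s ([:0, 1:] * g)" by (metis mult.left_commute s_mult)
    then show ?thesis using c x s_closed[of "[:0, 1:] * g"] s_closed[of h] by algebra
  qed
  also have "\<dots> \<in> Q" using g h c x ideal.I_l_closed[OF Q_ideal]
    additive_subgroup.a_closed[OF ideal.axioms(1)[OF Q_ideal]] by simp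
  finally show "x \<otimes> a \<in> origin" unfolding origin_def using c x by blast
qed (auto simp: origin_def)

lemma Q_subset_origin: "Q \<subseteq> origin"
proof
  fix q assume q: "q \<in> Q"
  have "s ([:0, 1:] * 0) = \<zero>" by simp
  then have "q \<ominus> s ([:0, 1:] * 0) \<in> Q" using q Q_sub[OF q] by (simp add: a_minus_def)
  then show "q \<in> origin" unfolding origin_def using q Q_sub by blast
qed

lemma s_in_origin: "s g \<in> origin \<longleftrightarrow> [:0, 1:] dvd g"
proof
  assume "s g \<in> origin"
  then obtain h where "s g \<ominus> s ([:0, 1:] * h) \<in> Q" unfolding origin_def by blast
  then have "g - [:0, 1:] * h = 0" using s_Q s_minus by metis
  then have "g = [:0, 1:] * h" by (simp only: right_minus_eq)
  then show "[:0, 1:] dvd g" by (rule dvdI)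
next
  assume "[:0, 1:] dvd g"
  then obtain h where h: "g = [:0, 1:] * h" by (elim dvdE)
  have "s g \<ominus> s ([:0, 1:] * h) = \<zero>" unfolding h using s_closed by (simp add: a_minus_def r_neg)
  then show "s g \<in> origin" unfolding origin_def
    using additive_subgroup.zero_closed[OF ideal.axioms(1)[OF Q_ideal]] s_closed by (metis (mono_tags, lifting) mem_Collect_eq)
qed

lemma origin_maximal: "maximalideal origin R"
proof (rule maximalidealI[OF origin_ideal])
  have "\<not> [:0, 1:] dvd (1 :: 'k poly)"
    by (auto simp: is_unit_iff_degree)
  then have "s 1 \<notin> origin" by (simp add: s_in_origin)
  then show "carrier R \<noteq> origin" by blast
next
  fix J assume J: "ideal J R" "origin \<subseteq> J" "J \<subseteq> carrier R"
  show "J = origin \<or> J = carrier R"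
  proof (rule disjCI)
    assume "J \<noteq> carrier R"
    then have one: "\<one> \<notin> J" using J ideal.one_imp_carrier by blast
    show "J = origin"
    proof (rule antisym[OF _ J(2)], rule subsetI, rule ccontr)
      fix r assume r: "r \<in> J" "r \<notin> origin"
      then have c: "r \<in> carrier R" using J by blast
      obtain g where g: "r \<ominus> s g \<in> Q" using decomp c by blast
      have sg: "s g \<in> J" "s g \<notin> origin"
        using mem_iff_s[OF J(1) _ c g] mem_iff_s[OF origin_ideal Q_subset_origin c g] Q_subset_origin J(2) r
        by blast+
      \<comment> \<open>Outside \<open>origin\<close> the constant term of \<open>g\<close> is
        nonzero. The rest of \<open>g\<close> maps into \<open>origin\<close>, so this unit constant
        maps into \<open>J\<close>.\<close>
      obtain b h where gb: "g = pCons b h" by (cases g)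
      then have gh: "g = [:b:] + [:0, 1:] * h" by simp
      have b: "b \<noteq> 0"
      proof
        assume "b = 0"
        then have "g = [:0, 1:] * h" using gh by (simp only: pCons_0_0 add_0)
        then have "[:0, 1:] dvd g" by (rule dvdI)
        then show False using sg(2) s_in_origin by simp
      qed
      have "s ([:0, 1:] * h) \<in> origin" by (simp only: s_in_origin dvd_triv_left)
      then have "s ([:0, 1:] * h) \<in> J" using J(2) by blast
      moreover have "[:b:] = g - [:0, 1:] * h" by (simp add: gb)
      ultimately have "s [:b:] \<in> J" using sg(1) ideal_minus[OF J(1)] s_minus by metis
      then have "s ([:1 / b:] * [:b:]) \<in> J" unfolding s_mult using ideal.I_l_closed[OF J(1)] by blast
      moreover have "[:1 / b:] * [:b:] = 1" using b by (simp add: one_pCons)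
      ultimately show False using one s_one by metis
    qed
  qed
qed

lemma Q_not_maximal: "\<not> maximalideal Q R"
proof
  assume "maximalideal Q R"
  moreover have "origin \<subseteq> carrier R" unfolding origin_def by blast
  ultimately have "origin = Q \<or> origin = carrier R"
    using maximalideal.I_maximal[OF _ origin_ideal Q_subset_origin] by blast
  moreover have "s [:0, 1:] \<in> origin" "s [:0, 1:] \<notin> Q"
    using s_in_origin[of "[:0, 1:]"] s_Q[of "[:0, 1:]"] by auto
  moreover have "origin \<noteq> carrier R" using maximalideal.I_notcarr[OF origin_maximal] by simp
  ultimately show False by blast
qed

text \<open>Ideals strictly above \<open>Q\<close> correspond to nonzero ideals of the principal
  ideal domain K[t].\<close>

lemma ideal_generator:
  assumes I: "ideal I R" "Q \<subset> I"
  obtains d where "s d \<in> I" "d \<noteq> 0" "\<And>g. s g \<in> I \<Longrightarrow> d dvd g"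
proof (rule poly_set_generator[of "{g. s g \<in> I}"])
  obtain r where r: "r \<in> I" "r \<notin> Q" using I by blast
  have c: "r \<in> carrier R" using r I by (auto dest: additive_subgroup.a_Hcarr[OF ideal.axioms(1)])
  obtain g where g: "r \<ominus> s g \<in> Q" using decomp c by blast
  have "s g \<in> I" "s g \<notin> Q" using mem_iff_s[OF _ _ c g] I r Q_ideal by blast+
  then show "\<exists>g \<in> {g. s g \<in> I}. g \<noteq> 0"
    using additive_subgroup.zero_closed[OF ideal.axioms(1)[OF Q_ideal]] by (intro bexI[of _ g]) auto
qed (use that I in \<open>auto simp: s_add s_mult ideal.I_l_closed
      additive_subgroup.a_closed[OF ideal.axioms(1)]\<close>)

text \<open>Nonzero primes of K[t] are maximal. If \<open>p\<close> and \<open>d\<close> generate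
  the polynomials belonging to \<open>P\<close> and \<open>J\<close>, then p = d e. Having
  \<open>s e\<close> in \<open>P\<close> would make \<open>d\<close> a unit, so primality puts
  \<open>s d\<close> into \<open>P\<close>.\<close>

lemma prime_above_Q_maximal:
  assumes P: "primeideal P R" "Q \<subset> P"
  shows "maximalideal P R"
proof -
  interpret P: primeideal P R by fact
  show ?thesis
  proof (rule maximalidealI[OF P.is_ideal P.I_notcarr])
    fix J assume J: "ideal J R" "P \<subseteq> J" "J \<subseteq> carrier R"
    show "J = P \<or> J = carrier R"
    proof (rule disjCI)
      assume "J \<noteq> carrier R"
      then have one: "\<one> \<notin> J" using J ideal.one_imp_carrier by blast
      obtain p where p: "s p \<in> P" "p \<noteq> 0" "\<And>g. s g \<in> P \<Longrightarrow> p dvd g"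
        using ideal_generator[OF P.is_ideal P(2)] by blast
      have QJ: "Q \<subset> J" using P(2) J(2) by blast
      obtain d where d: "s d \<in> J" "d \<noteq> 0" "\<And>g. s g \<in> J \<Longrightarrow> d dvd g"
        using ideal_generator[OF J(1) QJ] by blast
      have "s p \<in> J" using p J by blast
      then obtain e where e: "p = d * e" using d(3) by (blast elim: dvdE)
      have "s d \<otimes> s e \<in> P" using p(1) by (simp add: e s_mult)
      then have "s d \<in> P \<or> s e \<in> P" using P.I_prime by simp
      moreover have "s e \<notin> P"
      proof
        assume "s e \<in> P"
        then have "d * e dvd e" using p(3) e by simp
        then have "d dvd 1" using p(2) e by (metis dvd_times_right_cancel_iff mult_1 mult_zero_right)
        then obtain f where f: "1 = d * f" by (elim dvdE)
        have "s d \<otimes> s f \<in> J" using d(1) ideal.I_r_closed[OF J(1)] by blast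
        then show False using one s_mult[of d f] s_one f by metis
      qed
      ultimately have sd: "s d \<in> P" by blast
      have "J \<subseteq> P"
      proof
        fix r assume r: "r \<in> J"
        have c: "r \<in> carrier R" using r J by blast
        obtain g where g: "r \<ominus> s g \<in> Q" using decomp c by blast
        have "s g \<in> J" using mem_iff_s[OF J(1) _ c g] QJ r by blast
        then obtain f where f: "g = d * f" using d(3) by (blast elim: dvdE)
        have "s g \<in> P" unfolding f s_mult using sd P.I_r_closed by blast
        then show "r \<in> P" using mem_iff_s[OF P.is_ideal _ c g] P(2) by blast
      qed
      then show "J = P" using J(2) by blast
    qed
  qed
qed

lemma Q_psubset_maximal:
  assumes "maximalideal P R" shows "Q \<subset> P"
  using assms maximalideal_prime prime_Q_subset Q_not_maximal by auto

text \<open>The chain \<open>Q\<close>, \<open>P\<close> shows height at least one. In a chain of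
  three primes the middle one lies strictly above \<open>Q\<close>, hence is maximal and cannot lie
  properly inside the third.\<close>

lemma prime_height_maximal:
  assumes P: "maximalideal P R" shows "prime_height R P = 1"
  unfolding prime_height_def
proof (rule antisym)
  let ?S = "{ps. ps \<noteq> [] \<and> last ps = P \<and> (\<forall>Q\<in>set ps. primeideal Q R) \<and> sorted_wrt (\<subset>) ps}"
  have "[Q, P] \<in> ?S" using P maximalideal_prime prime_Q Q_psubset_maximal by auto
  then have "enat (length [Q, P] - 1) \<le> (SUP ps\<in>?S. enat (length ps - 1))" by (rule SUP_upper)
  then show "1 \<le> (SUP ps\<in>?S. enat (length ps - 1))" by (simp add: one_enat_def)
  show "(SUP ps\<in>?S. enat (length ps - 1)) \<le> 1"
  proof (rule SUP_least)
    fix ps assume ps: "ps \<in> ?S"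
    have "length ps \<le> 2"
    proof (rule ccontr)
      assume "\<not> length ps \<le> 2"
      then have l: "2 < length ps" by simp
      define A B C where "A = ps ! 0" "B = ps ! 1" "C = ps ! 2"
      have "ps ! i \<in> set ps" if "i \<le> 2" for i using l that by (intro nth_mem) simp
      then have "A \<in> set ps" "B \<in> set ps" "C \<in> set ps" by (simp_all add: A_B_C_def)
      then have "primeideal A R" "primeideal B R" "primeideal C R" using ps by auto
      moreover have "A \<subset> B" "B \<subset> C"
        using ps l sorted_wrt_nth_less[of "(\<subset>)" ps 0 1] sorted_wrt_nth_less[of "(\<subset>)" ps 1 2]
        unfolding A_B_C_def by auto
      moreover have "Q \<subseteq> A" using \<open>primeideal A R\<close> by (rule prime_Q_subset)
      ultimately have "maximalideal B R" using prime_above_Q_maximal[of B] by blast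
      moreover have "C \<subseteq> carrier R" "C \<noteq> carrier R" "ideal C R"
        using \<open>primeideal C R\<close> additive_subgroup.a_subset[OF ideal.axioms(1)] primeideal.axioms(1)
          primeideal.I_notcarr by blast+
      ultimately show False using maximalideal.I_maximal[of B R C] \<open>B \<subset> C\<close> by blast
    qed
    then show "enat (length ps - 1) \<le> 1" by (simp add: one_enat_def)
  qed
qed

text \<open>Since \<open>origin\<close> has height one, it contains a regular element y, which
  equals s(t g) modulo \<open>Q\<close> for some g. If s(t) kills \<open>z\<close>, so does s(t g),
  and hence a power of y; regularity gives z = 0.\<close>

theorem cohen_macaulay_imp_regular:
  assumes CM: "cohen_macaulay R" and z: "z \<in> carrier R" and xz: "s [:0, 1:] \<otimes> z = \<zero>"
  shows "z = \<zero>"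
proof -
  have "ideal_depth R origin = 1"
    using CM origin_maximal prime_height_maximal unfolding cohen_macaulay_def by metis
  then have "\<not> ideal_depth R origin \<le> 0" by simp
  then obtain xs where xs: "regular_sequence R xs" "set xs \<subseteq> origin" "length xs \<noteq> 0"
    unfolding ideal_depth_def SUP_le_iff by (auto simp: zero_enat_def)
  then have y: "xs ! 0 \<in> origin" using nth_mem[of 0 xs] by auto
  have reg: "z \<in> {\<zero>}" if "z \<in> carrier R" "xs ! 0 \<otimes> z \<in> {\<zero>}" for z
    using xs(1,3) that unfolding regular_sequence_def
    by (elim conjE allE[of _ 0]) (simp add: genideal_empty)
  have yc: "xs ! 0 \<in> carrier R" using y by (simp add: origin_def)
  obtain g where g: "xs ! 0 \<ominus> s ([:0, 1:] * g) \<in> Q" using y unfolding origin_def by blast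
  let ?A = "{r \<in> carrier R. r \<otimes> z \<in> {\<zero>}}"
  have A: "ideal ?A R" by (rule colon_ideal[OF zeroideal z])
  have "s ([:0, 1:] * g) \<in> ?A"
    using xz z s_mult[of g "[:0, 1:]"] by (simp add: mult.commute[of _ g] m_assoc)
  then obtain k where "xs ! 0 [^] (k::nat) \<in> ?A" using nil_pow[OF A _ yc g] by blast
  then have "xs ! 0 [^] k \<otimes> z \<in> {\<zero>}" by simp
  then show ?thesis using regular_pow[OF reg yc z] by blast
qed

end

section \<open>Torsion-freeness over K[t] and the Cohen-Macaulay property\<close>

lemma pcompose_monom_monom:
  "pcompose (Polynomial.monom a j) (Polynomial.monom 1 n) = (Polynomial.monom a (n * j) :: 'k :: comm_ring_1 poly)"
proof (induction j)
  case 0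
  then show ?case by (simp add: monom_0)
next
  case (Suc j)
  then show ?case by (simp add: monom_Suc[of a j] pcompose_pCons mult_monom)
qed

lemma pcompose_monom_eq_0_iff:
  fixes g :: "'k :: field poly"
  assumes "n > 0" shows "pcompose g (Polynomial.monom 1 n) = 0 \<longleftrightarrow> g = 0"
  using assms by (intro pcompose_eq_0_iff) (simp add: degree_monom_eq)

text \<open>\<open>\<Lambda>\<close> embeds R in K[t] as a module over K[t], acting on the target
  through the substitution of t^n for t; it is not asked to be multiplicative on all of R. Nonzero
  polynomials therefore act injectively on R.\<close>

locale weighted_line_plus_nil = line_plus_nil R s Q
  for R (structure) and s :: "'k :: field poly \<Rightarrow> 'a" and Q +
  fixes \<Lambda> :: "'a \<Rightarrow> 'k poly" and n :: nat
  assumes n_pos: "n > 0"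
    and \<Lambda>_add: "a \<in> carrier R \<Longrightarrow> b \<in> carrier R \<Longrightarrow> \<Lambda> (a \<oplus> b) = \<Lambda> a + \<Lambda> b"
    and \<Lambda>_s: "a \<in> carrier R \<Longrightarrow> \<Lambda> (s g \<otimes> a) = pcompose g (Polynomial.monom 1 n) * \<Lambda> a"
    and \<Lambda>_eq_0: "a \<in> carrier R \<Longrightarrow> \<Lambda> a = 0 \<Longrightarrow> a = \<zero>"
begin

lemma \<Lambda>_zero [simp]: "\<Lambda> \<zero> = 0"
  using \<Lambda>_add[of \<zero> \<zero>] by (metis add_cancel_right_right l_zero zero_closed)

lemma \<Lambda>_minus: "a \<in> carrier R \<Longrightarrow> b \<in> carrier R \<Longrightarrow> \<Lambda> (a \<ominus> b) = \<Lambda> a - \<Lambda> b"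
proof -
  assume c: "a \<in> carrier R" "b \<in> carrier R"
  then have "(a \<ominus> b) \<oplus> b = a" by algebra
  then have "\<Lambda> a = \<Lambda> (a \<ominus> b) + \<Lambda> b" using c \<Lambda>_add[of "a \<ominus> b" b] by simp
  then show ?thesis by simp
qed

lemma s_regular:
  assumes "g \<noteq> 0" "z \<in> carrier R" "s g \<otimes> z = \<zero>"
  shows "z = \<zero>"
  using assms \<Lambda>_s[of z g] \<Lambda>_eq_0[of z] n_pos by (simp add: pcompose_monom_eq_0_iff)

text \<open>
  An ideal is generated by elements whose images under \<open>\<Lambda>\<close> have the least possible degree in each
  residue class modulo \<open>n\<close>.
\<close>

lemma noetherian: "noetherian_ring R"
proof (rule noetherian_ringI)
  fix I assume I: "ideal I R"
  have Isub: "I \<subseteq> carrier R" using additive_subgroup.a_subset[OF ideal.axioms(1)[OF I]] .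
  let ?M = "\<lambda>c r. r \<in> I \<and> \<Lambda> r \<noteq> 0 \<and> degree (\<Lambda> r) mod n = c"
  have "\<exists>r. (\<exists>r. ?M c r) \<longrightarrow> ?M c r \<and> (\<forall>r'. ?M c r' \<longrightarrow> degree (\<Lambda> r) \<le> degree (\<Lambda> r'))" for c
    using ex_has_least_nat[of "?M c" _ "\<lambda>r. degree (\<Lambda> r)"] by (metis (no_types, lifting))
  then obtain f where f: "\<And>c r. ?M c r \<Longrightarrow> ?M c (f c) \<and> degree (\<Lambda> (f c)) \<le> degree (\<Lambda> r)"
    by metis
  define A where "A = f ` {c. c < n \<and> (\<exists>r. ?M c r)}"
  have "finite A" by (simp add: A_def)
  have AI: "A \<subseteq> I" using f unfolding A_def by blast
  have Ac: "A \<subseteq> carrier R" using AI Isub by blast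
  have G: "ideal (Idl A) R" using genideal_ideal[OF Ac] .
  have "r \<in> Idl A" if "r \<in> I" for r
    using that
  \<comment> \<open>Zero gets a rank of its own, since \<open>degree\<close> does not separate it
    from nonzero constants.\<close>
  proof (induction "if \<Lambda> r = 0 then 0 else Suc (degree (\<Lambda> r))" arbitrary: r rule: less_induct)
    case less
    have rc: "r \<in> carrier R" using less.prems Isub by blast
    show ?case
    proof (cases "\<Lambda> r = 0")
      case True
      then show ?thesis using \<Lambda>_eq_0[OF rc] additive_subgroup.zero_closed[OF ideal.axioms(1)[OF G]] by simp
    next
      case False
      define c where "c = degree (\<Lambda> r) mod n"
      have fc: "?M c (f c)" "degree (\<Lambda> (f c)) \<le> degree (\<Lambda> r)"
        using f[of r c] less.prems False c_def by blast+
      have fA: "f c \<in> A" using less.prems False c_def n_pos unfolding A_def by auto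
      then have fi: "f c \<in> Idl A" and fcar: "f c \<in> carrier R" using genideal_self[OF Ac] Ac by blast+
      \<comment> \<open>Multiplying \<open>f c\<close> by s(\<alpha> t^j) multiplies its image by
        \<alpha> t^(n j), which matches the leading term of the image of \<open>r\<close>.\<close>
      define \<alpha> where "\<alpha> = lead_coeff (\<Lambda> r) / lead_coeff (\<Lambda> (f c))"
      define j where "j = (degree (\<Lambda> r) - degree (\<Lambda> (f c))) div n"
      have "n dvd degree (\<Lambda> r) - degree (\<Lambda> (f c))"
        using fc c_def mod_eq_dvd_iff_nat[of "degree (\<Lambda> (f c))" "degree (\<Lambda> r)" n] by auto
      then have j: "n * j + degree (\<Lambda> (f c)) = degree (\<Lambda> r)" using fc(2) by (simp add: j_def)
      have \<alpha>: "\<alpha> \<noteq> 0" using False fc by (simp add: \<alpha>_def)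
      define r' where "r' = r \<ominus> s (Polynomial.monom \<alpha> j) \<otimes> f c"
      have r': "r' \<in> I" unfolding r'_def
        using less.prems fc(1) ideal_minus[OF I] ideal.I_l_closed[OF I] by simp
      have eq: "\<Lambda> r' = \<Lambda> r - Polynomial.monom \<alpha> (n * j) * \<Lambda> (f c)"
        unfolding r'_def using rc fcar by (simp add: \<Lambda>_minus \<Lambda>_s pcompose_monom_monom)
      have d: "degree (Polynomial.monom \<alpha> (n * j) * \<Lambda> (f c)) = degree (\<Lambda> r)"
        using \<alpha> fc(1) j by (simp add: degree_mult_eq degree_monom_eq monom_eq_0_iff)
      moreover have "coeff (Polynomial.monom \<alpha> (n * j) * \<Lambda> (f c)) (degree (\<Lambda> r)) = lead_coeff (\<Lambda> r)"
        using fc(1) by (simp add: coeff_monom_mult j[symmetric]) (simp add: \<alpha>_def j)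
      ultimately have "\<Lambda> r' = 0 \<or> degree (\<Lambda> r') < degree (\<Lambda> r)"
        unfolding eq by (metis (no_types, lifting) coeff_diff degree_diff_le dual_order.refl eq_iff_diff_eq_0 leading_coeff_0_iff
            le_neq_implies_less)
      then have "r' \<in> Idl A" using less.hyps[OF _ r'] False by (auto split: if_splits)
      moreover have "r \<ominus> s (Polynomial.monom \<alpha> j) \<otimes> f c \<in> Idl A \<Longrightarrow> r \<in> Idl A"
        using ideal_diff_imp[OF G rc] ideal.I_l_closed[OF G fi] by blast
      ultimately show ?thesis unfolding r'_def by blast
    qed
  qed
  then have "I = Idl A" using genideal_minimal[OF I AI] by blast
  then show "\<exists>A \<subseteq> carrier R. finite A \<and> I = Idl A" using \<open>finite A\<close> Ac by blast
qed

lemma maximal_sub: "maximalideal P R \<Longrightarrow> P \<subseteq> carrier R"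
  using additive_subgroup.a_subset[OF ideal.axioms(1)] maximalideal.axioms(1) by blast

text \<open>A nonzero polynomial belonging to \<open>P\<close> gives a regular sequence of length
  one, by torsion-freeness.\<close>

lemma ideal_depth_ge_1:
  assumes P: "maximalideal P R" shows "1 \<le> ideal_depth R P"
proof -
  have I: "ideal P R" using P maximalideal.axioms(1) by blast
  obtain p where p: "s p \<in> P" "p \<noteq> 0"
    using ideal_generator[OF I Q_psubset_maximal[OF P]] by blast
  have "Idl {s p} \<subseteq> P" using genideal_minimal[OF I] p(1) by simp
  moreover have "P \<noteq> carrier R" using maximalideal.I_notcarr[OF P] by simp
  ultimately have "Idl {s p} \<noteq> carrier R" using maximal_sub[OF P] by blast
  then have "regular_sequence R [s p]"
    unfolding regular_sequence_def using s_regular[OF p(2)] by (simp add: genideal_empty)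
  then have "[s p] \<in> {xs. regular_sequence R xs \<and> set xs \<subseteq> P}" using p(1) by simp
  then have "enat (length [s p]) \<le> ideal_depth R P" unfolding ideal_depth_def by (rule SUP_upper)
  then show ?thesis by (simp add: one_enat_def)
qed

text \<open>Let \<open>p\<close> generate the polynomials of \<open>P\<close>, let \<open>h\<close>
  represent \<open>y'\<close>, and let \<open>G\<close> be a nonzero polynomial of least degree in
  the ideal of \<open>y\<close>. Both \<open>h\<close> and \<open>G\<close> are multiples of
  \<open>p\<close>, so \<open>h\<close> times G/p falls into that ideal. Regularity then puts G/p
  there, so \<open>p\<close> is constant and \<open>P\<close> is not proper.\<close>

lemma no_regular_pair:
  assumes P: "maximalideal P R" and y: "y \<in> P" "y' \<in> P"
    and reg: "\<And>z. z \<in> carrier R \<Longrightarrow> y \<otimes> z = \<zero> \<Longrightarrow> z = \<zero>"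
    and reg': "\<And>z. z \<in> carrier R \<Longrightarrow> y' \<otimes> z \<in> Idl {y} \<Longrightarrow> z \<in> Idl {y}"
  shows False
proof -
  have PI: "ideal P R" using P maximalideal.axioms(1) by blast
  have QP: "Q \<subset> P" using Q_psubset_maximal[OF P] .
  have c: "y \<in> carrier R" "y' \<in> carrier R" using y maximal_sub[OF P] by blast+
  let ?I = "Idl {y}"
  have I: "ideal ?I R" and yI: "y \<in> ?I" and IP: "?I \<subseteq> P"
    using genideal_ideal genideal_self' genideal_minimal[OF PI] c y by auto
  obtain p where p: "s p \<in> P" "p \<noteq> 0" "\<And>g. s g \<in> P \<Longrightarrow> p dvd g"
    using ideal_generator[OF PI QP] by blast
  obtain g where g: "y \<ominus> s g \<in> Q" using decomp c by blast
  obtain h where h: "y' \<ominus> s h \<in> Q" using decomp c by blast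
  have "s h \<in> P" using mem_iff_s[OF PI _ c(2) h] QP y by blast
  then have "p dvd h" by (rule p(3))
  then obtain h1 where h1: "h = p * h1" by (elim dvdE)
  \<comment> \<open>Regularity modulo the ideal of \<open>y\<close> passes from \<open>y'\<close> to
    its representative: if \<open>s h\<close> multiplies \<open>z\<close> into the ideal, so does a
    power of \<open>y'\<close>.\<close>
  have sh: "z \<in> ?I" if z: "z \<in> carrier R" "s h \<otimes> z \<in> ?I" for z
  proof -
    have "s h \<in> {r \<in> carrier R. r \<otimes> z \<in> ?I}" using z by simp
    then obtain k where "y' [^] (k::nat) \<in> {r \<in> carrier R. r \<otimes> z \<in> ?I}"
      using nil_pow[OF colon_ideal[OF I z(1)] _ c(2) h] by blast
    then show ?thesis using regular_pow[of y' ?I] reg' c(2) z(1) by blast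
  qed
  \<comment> \<open>Otherwise \<open>y\<close> is nilpotent as well as regular, which forces 1 =
    0.\<close>
  have "g \<noteq> 0"
  proof
    assume "g = 0"
    then have "s g \<in> Q" using additive_subgroup.zero_closed[OF ideal.axioms(1)[OF Q_ideal]] by simp
    then have "y \<in> Q" using mem_iff_s[OF Q_ideal _ c(1) g] by blast
    then obtain k where k: "y [^] (k::nat) = \<zero>" using Q_nil by blast
    have "\<one> \<in> {\<zero>}"
    proof (rule regular_pow[of y _ _ k])
      show "z \<in> {\<zero>}" if "z \<in> carrier R" "y \<otimes> z \<in> {\<zero>}" for z using reg that by blast
    qed (simp_all add: c k)
    then have "\<one> = \<zero>" by blast
    then have "s 1 \<in> Q" using s_one additive_subgroup.zero_closed[OF ideal.axioms(1)[OF Q_ideal]] by simp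
    then show False using s_Q[of 1] by simp
  qed
  have "s g \<ominus> y \<in> Q" using ideal_diff_commute[OF Q_ideal c(1) s_closed g] .
  \<comment> \<open>A power of \<open>g\<close> is the nonzero polynomial needed to start the
    minimal choice of \<open>G\<close>.\<close>
  then obtain k where "s g [^] (k::nat) \<in> ?I" using nil_pow[OF I yI s_closed] by blast
  then have "s (g ^ k) \<in> ?I" by (simp add: s_pow)
  moreover have "g ^ k \<noteq> 0" using \<open>g \<noteq> 0\<close> by simp
  ultimately obtain G where G: "s G \<in> ?I" "G \<noteq> 0"
    and min: "\<And>G'. s G' \<in> ?I \<Longrightarrow> G' \<noteq> 0 \<Longrightarrow> degree G \<le> degree G'"
    using ex_has_least_nat[of "\<lambda>G. s G \<in> ?I \<and> G \<noteq> 0" "g ^ k" degree] by blast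
  have "s G \<in> P" using G(1) IP by blast
  then have "p dvd G" by (rule p(3))
  then obtain G1 where G1: "G = p * G1" by (elim dvdE)
  have "s h \<otimes> s G1 = s h1 \<otimes> s G"
    unfolding s_mult[symmetric] G1 h1 by (simp add: ac_simps)
  then have "s h \<otimes> s G1 \<in> ?I" using ideal.I_l_closed[OF I G(1), of "s h1"] by simp
  then have "s G1 \<in> ?I" using sh by simp
  moreover have "G1 \<noteq> 0" using G(2) G1 by auto
  ultimately have "degree G \<le> degree G1" using min by blast
  then have "degree p = 0" using G1 p(2) \<open>G1 \<noteq> 0\<close> by (simp add: degree_mult_eq)
  then have "p dvd 1" using p(2) is_unit_iff_degree by blast
  then obtain q where q: "1 = p * q" by (elim dvdE)
  have "s p \<otimes> s q \<in> P" using ideal.I_r_closed[OF PI p(1)] by simp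
  then have "\<one> \<in> P" using q s_mult[of p q] s_one by metis
  then show False using ideal.one_imp_carrier[OF PI] maximalideal.I_notcarr[OF P] by simp
qed

text \<open>Depth and height both equal one at every maximal ideal.\<close>

theorem cohen_macaulay: "cohen_macaulay R"
  unfolding cohen_macaulay_def
proof (intro conjI allI impI)
  fix P assume P: "maximalideal P R"
  have "ideal_depth R P \<le> 1"
    unfolding ideal_depth_def
  proof (rule SUP_least)
    fix xs assume xs: "xs \<in> {xs. regular_sequence R xs \<and> set xs \<subseteq> P}"
    have "length xs \<le> 1"
    proof (rule ccontr)
      assume "\<not> length xs \<le> 1"
      then obtain y y' ys where ys: "xs = y # y' # ys"
        by (cases xs; cases "tl xs") auto
      have reg: "\<forall>i < length xs. \<forall>z \<in> carrier R.
        xs ! i \<otimes> z \<in> Idl (set (take i xs)) \<longrightarrow> z \<in> Idl (set (take i xs))"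
        using xs unfolding regular_sequence_def by blast
      show False
      proof (rule no_regular_pair[OF P])
        show "y \<in> P" "y' \<in> P" using xs ys by auto
        show "z = \<zero>" if "z \<in> carrier R" "y \<otimes> z = \<zero>" for z
          using reg[rule_format, of 0 z] that ys by (simp add: genideal_empty)
        show "z \<in> Idl {y}" if "z \<in> carrier R" "y' \<otimes> z \<in> Idl {y}" for z
          using reg[rule_format, of 1 z] that ys by simp
      qed
    qed
    then show "enat (length xs) \<le> 1" by (simp add: one_enat_def)
  qed
  then show "ideal_depth R P = prime_height R P"
    using ideal_depth_ge_1[OF P] prime_height_maximal[OF P] by simp
qed (auto intro: is_cring noetherian)

end

section \<open>Initial forms of toric ideals\<close>

abbreviation mon :: "('v \<Rightarrow>\<^sub>0 nat) \<Rightarrow> ('v, 'k :: comm_ring_1) mpoly" where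
  "mon m \<equiv> Poly_Mapping.single m 1"

lemma mon_eq_iff: "(mon m :: ('v, 'k :: comm_ring_1) mpoly) = mon m' \<longleftrightarrow> m = m'"
  by (metis keys_single singleton_inject zero_neq_one)

lemma mpoly_expand:
  "f = (\<Sum>m \<in> Poly_Mapping.keys f. Poly_Mapping.single m (Poly_Mapping.lookup f m))"
  for f :: "('v, 'k :: comm_ring_1) mpoly"
  by (rule poly_mapping_eqI) (simp add: lookup_sum lookup_single when_def in_keys_iff)

lemma mpoly_induct [case_names zero add]:
  fixes f :: "('v, 'k :: comm_ring_1) mpoly"
  assumes "P 0" and "\<And>m c f. P f \<Longrightarrow> P (Poly_Mapping.single m c + f)"
  shows "P f"
proof -
  have "P (\<Sum>m\<in>A. Poly_Mapping.single m (Poly_Mapping.lookup f m))" if "finite A" for A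
    using that by (induction A rule: finite_induct) (simp_all add: assms)
  then show ?thesis using mpoly_expand[of f] by (metis finite_keys)
qed

lemma var_power: "var i ^ k = (mon (Poly_Mapping.single i k) :: ('v, 'k :: comm_ring_1) mpoly)"
  by (induction k) (simp_all add: var_def mult_single flip: single_add)

text \<open>The coefficients of both \<open>curve_map\<close> and \<open>graded_map\<close> have
  this shape, so linearity and shifts by monomials are handled once.\<close>

definition coeff_sum :: "(('v \<Rightarrow>\<^sub>0 nat) \<Rightarrow> bool) \<Rightarrow> ('v, 'k :: comm_ring_1) mpoly \<Rightarrow> 'k" where
  "coeff_sum S f = (\<Sum>m | m \<in> Poly_Mapping.keys f \<and> S m. Poly_Mapping.lookup f m)"

lemma coeff_sum_superset:
  assumes "finite A" "Poly_Mapping.keys f \<subseteq> A"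
  shows "coeff_sum S f = (\<Sum>m\<in>A. if S m then Poly_Mapping.lookup f m else 0)"
proof -
  have "coeff_sum S f = (\<Sum>m\<in>Poly_Mapping.keys f. if S m then Poly_Mapping.lookup f m else 0)"
    unfolding coeff_sum_def by (simp add: sum.If_cases Int_def)
  also have "\<dots> = (\<Sum>m\<in>A. if S m then Poly_Mapping.lookup f m else 0)"
    using assms by (intro sum.mono_neutral_left) (auto simp: in_keys_iff)
  finally show ?thesis .
qed

lemma coeff_sum_zero [simp]: "coeff_sum S 0 = 0"
  by (simp add: coeff_sum_def)

lemma coeff_sum_single: "coeff_sum S (Poly_Mapping.single m c) = (if S m then c else 0)"
  by (subst coeff_sum_superset[of "{m}"]) auto

lemma coeff_sum_add: "coeff_sum S (f + g) = coeff_sum S f + coeff_sum S g"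
proof -
  let ?A = "Poly_Mapping.keys f \<union> Poly_Mapping.keys g"
  have "coeff_sum S (f + g) = (\<Sum>m\<in>?A. if S m then Poly_Mapping.lookup (f + g) m else 0)"
    using keys_add[of f g] by (intro coeff_sum_superset) auto
  also have "\<dots> = (\<Sum>m\<in>?A. if S m then Poly_Mapping.lookup f m else 0)
      + (\<Sum>m\<in>?A. if S m then Poly_Mapping.lookup g m else 0)"
    unfolding sum.distrib[symmetric] by (rule sum.cong) (auto simp: lookup_add)
  also have "\<dots> = coeff_sum S f + coeff_sum S g"
    by (simp add: coeff_sum_superset[of ?A])
  finally show ?thesis .
qed

lemma coeff_sum_minus: "coeff_sum S (f - g) = coeff_sum S f - coeff_sum S g"
  using coeff_sum_add[of S "f - g" g] by simp

lemma coeff_sum_mult_single: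
  "coeff_sum S (Poly_Mapping.single m c * f) = c * coeff_sum (\<lambda>m'. S (m + m')) f"
  by (induction f rule: mpoly_induct)
     (simp_all add: distrib_left mult_single coeff_sum_add coeff_sum_single)

section \<open>Weights, degrees and maximal monomials\<close>

definition weight :: "('v :: finite \<Rightarrow> nat) \<Rightarrow> ('v \<Rightarrow>\<^sub>0 nat) \<Rightarrow> nat" where
  "weight n m = (\<Sum>i\<in>UNIV. n i * Poly_Mapping.lookup m i)"

lemma weight_add: "weight n (m + m') = weight n m + weight n m'"
  by (simp add: weight_def lookup_add algebra_simps sum.distrib)

lemma total_degree_add: "total_degree (m + m') = total_degree m + total_degree m'"
  by (simp add: total_degree_def lookup_add sum.distrib)

lemma weight_single [simp]: "weight n (Poly_Mapping.single i k) = n i * k"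
  by (simp add: weight_def lookup_single when_def if_distrib cong: if_cong)

lemma total_degree_single [simp]: "total_degree (Poly_Mapping.single i k) = k"
  by (simp add: total_degree_def lookup_single when_def)

lemma coeff_curve_map:
  fixes f :: "('v :: finite, 'k :: field) mpoly"
  shows "coeff (curve_map n f) k = coeff_sum (\<lambda>m. weight n m = k) f"
proof -
  have "(\<Prod>i\<in>I. Polynomial.monom (1 :: 'k) (n i) ^ Poly_Mapping.lookup m i) =
      Polynomial.monom 1 (\<Sum>i\<in>I. n i * Poly_Mapping.lookup m i)" if "finite I" for I :: "'v set" and m
    using that by (induction I rule: finite_induct) (simp_all add: monom_power mult_monom)
  then have *: "(\<Prod>i\<in>UNIV. Polynomial.monom (1 :: 'k) (n i) ^ Poly_Mapping.lookup m i) = Polynomial.monom 1 (weight n m)" for m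
    by (simp add: weight_def)
  show ?thesis
    by (induction f rule: mpoly_induct)
       (simp_all add: curve_map_add curve_map_single * coeff_sum_add coeff_sum_single, simp add: curve_map_def)
qed

text \<open>These monomials survive in the tangent cone. Any other one is the initial form of its
  difference with a monomial of equal weight and larger degree.\<close>

definition maximal :: "('v :: finite \<Rightarrow> nat) \<Rightarrow> ('v \<Rightarrow>\<^sub>0 nat) \<Rightarrow> bool" where
  "maximal n m \<longleftrightarrow> (\<forall>m'. weight n m' = weight n m \<longrightarrow> total_degree m' \<le> total_degree m)"

lemma not_maximalI: "weight n m' = weight n m \<Longrightarrow> total_degree m < total_degree m' \<Longrightarrow> \<not> maximal n m"
  unfolding maximal_def by (metis not_le)

lemma maximal_cong:
  "weight n m = weight n m' \<Longrightarrow> total_degree m = total_degree m' \<Longrightarrow> maximal n m = maximal n m'"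
  by (simp add: maximal_def)

lemma maximal_total_degree_eq:
  "maximal n m \<Longrightarrow> maximal n m' \<Longrightarrow> weight n m = weight n m' \<Longrightarrow> total_degree m = total_degree m'"
  unfolding maximal_def by (metis le_antisym)

text \<open>An improvement of the factor \<open>m'\<close> would improve the product as
  well.\<close>

lemma maximal_addD: "maximal n (m + m') \<Longrightarrow> maximal n m'"
  unfolding maximal_def by (metis add_le_cancel_left weight_add total_degree_add)

text \<open>A linear map whose kernel turns out to be the ideal of initial forms. It need not be
  multiplicative, since a product of maximal monomials may fail to be maximal.\<close>

definition graded_map :: "('v :: finite \<Rightarrow> nat) \<Rightarrow> ('v, 'k :: comm_ring_1) mpoly \<Rightarrow> 'k poly" where
  "graded_map n f = (\<Sum>m | m \<in> Poly_Mapping.keys f \<and> maximal n m.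
     Polynomial.monom (Poly_Mapping.lookup f m) (weight n m))"

lemma coeff_graded_map: "coeff (graded_map n f) k = coeff_sum (\<lambda>m. maximal n m \<and> weight n m = k) f"
proof -
  have "coeff (graded_map n f) k = (\<Sum>m | m \<in> Poly_Mapping.keys f \<and> maximal n m.
      if weight n m = k then Poly_Mapping.lookup f m else 0)"
    unfolding graded_map_def by (simp add: Polynomial.coeff_sum)
  also have "\<dots> = coeff_sum (\<lambda>m. maximal n m \<and> weight n m = k) f"
    unfolding coeff_sum_def by (subst sum.inter_filter[symmetric]) (auto intro: sum.cong)
  finally show ?thesis .
qed

lemma graded_map_add: "graded_map n (f + g) = graded_map n f + graded_map n g"
  by (rule poly_eqI) (simp add: coeff_graded_map coeff_sum_add)

lemma graded_map_single:
  "graded_map n (Poly_Mapping.single m c) = (if maximal n m then Polynomial.monom c (weight n m) else 0)"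
  by (rule poly_eqI) (simp add: coeff_graded_map coeff_sum_single)

lemma graded_map_zero [simp]: "graded_map n 0 = 0"
  by (simp add: graded_map_def)

lemma graded_map_minus: "graded_map n (f - g) = graded_map n f - graded_map n g"
  using graded_map_add[of n "f - g" g] by simp

text \<open>Fix a monomial multiplier \<open>m\<close> and a weight \<open>k\<close>. If some
  product with \<open>m\<close> is maximal of weight \<open>k\<close>, then the exponents with this
  property are exactly the maximal ones of one fixed weight, so the coefficient is one of
  \<open>graded_map n f\<close>. Otherwise it is an empty sum.\<close>

lemma graded_map_mult_0:
  assumes "graded_map n f = 0" shows "graded_map n (g * f) = 0"
proof (induction g rule: mpoly_induct)
  case (add m c g)
  have "graded_map n (Poly_Mapping.single m c * f) = 0"
  proof (rule poly_eqI)
    fix k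
    have "coeff_sum (\<lambda>m'. maximal n (m + m') \<and> weight n (m + m') = k) f = 0"
    proof (cases "\<exists>m'. maximal n (m + m') \<and> weight n (m + m') = k")
      case True
      then obtain m0 where m0: "maximal n (m + m0)" "weight n (m + m0) = k" by blast
      have "maximal n (m + m') \<and> weight n (m + m') = k \<longleftrightarrow> maximal n m' \<and> weight n m' = weight n m0" for m'
      proof
        assume "maximal n (m + m') \<and> weight n (m + m') = k"
        then show "maximal n m' \<and> weight n m' = weight n m0" using m0 maximal_addD by (auto simp: weight_add)
      next
        assume *: "maximal n m' \<and> weight n m' = weight n m0"
        then have "total_degree m' = total_degree m0"
          using m0 maximal_addD maximal_total_degree_eq by blast
        then have "maximal n (m + m')"
          using m0 * maximal_cong[of n "m + m'" "m + m0"] by (simp add: weight_add total_degree_add)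
        then show "maximal n (m + m') \<and> weight n (m + m') = k" using * m0 by (simp add: weight_add)
      qed
      then have "coeff_sum (\<lambda>m'. maximal n (m + m') \<and> weight n (m + m') = k) f = coeff (graded_map n f) (weight n m0)"
        by (simp add: coeff_graded_map)
      then show ?thesis using assms by simp
    next
      case False
      then have "{m'. m' \<in> Poly_Mapping.keys f \<and> maximal n (m + m') \<and> weight n (m + m') = k} = {}" by blast
      then show ?thesis unfolding coeff_sum_def by (simp only: sum.empty)
    qed
    then show "coeff (graded_map n (Poly_Mapping.single m c * f)) k = coeff 0 k"
      by (simp add: coeff_graded_map coeff_sum_mult_single)
  qed
  then show ?case using add by (simp add: distrib_right graded_map_add)
qed simp

section \<open>The ideal of initial forms as a kernel\<close>

lemma mpoly_ring_simps [simp]: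
  "carrier mpoly_ring = UNIV" "f \<oplus>\<^bsub>mpoly_ring\<^esub> g = f + g" "f \<otimes>\<^bsub>mpoly_ring\<^esub> g = f * g"
  "\<zero>\<^bsub>mpoly_ring\<^esub> = 0" "\<one>\<^bsub>mpoly_ring\<^esub> = 1"
  by (simp_all add: mpoly_ring_def)

lemma mpoly_ideal_iff:
  "ideal J (mpoly_ring :: ('v, 'k :: comm_ring_1) mpoly ring) \<longleftrightarrow>
    0 \<in> J \<and> (\<forall>f\<in>J. \<forall>g\<in>J. f + g \<in> J) \<and> (\<forall>f\<in>J. \<forall>g. g * f \<in> J)"
proof
  assume J: "ideal J (mpoly_ring :: ('v, 'k) mpoly ring)"
  note add = ideal.axioms(1)[OF J]
  show "0 \<in> J \<and> (\<forall>f\<in>J. \<forall>g\<in>J. f + g \<in> J) \<and> (\<forall>f\<in>J. \<forall>g. g * f \<in> J)"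
    using additive_subgroup.zero_closed[OF add] additive_subgroup.a_closed[OF add] ideal.I_l_closed[OF J] by simp
qed (intro cring.idealI_cring[OF cring_mpoly_ring], auto)

lemma mpoly_ideal_minus:
  assumes "ideal J (mpoly_ring :: ('v, 'k :: comm_ring_1) mpoly ring)" "f \<in> J" "g \<in> J"
  shows "f - g \<in> J"
proof -
  have "f - g = f + (- 1) * g" by simp
  then show ?thesis using assms unfolding mpoly_ideal_iff by metis
qed

lemma lookup_homogeneous_component:
  "Poly_Mapping.lookup (homogeneous_component e p) m = (if total_degree m = e then Poly_Mapping.lookup p m else 0)"
  unfolding homogeneous_component_def
  by (auto simp: lookup_sum lookup_single when_def in_keys_iff sum.delta)

lemma initial_form_eqI:
  assumes "homogeneous_component e p \<noteq> 0" "\<And>m. m \<in> Poly_Mapping.keys p \<Longrightarrow> e \<le> total_degree m"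
  shows "initial_form p = homogeneous_component e p"
proof -
  have "(LEAST e. homogeneous_component e p \<noteq> 0) = e"
  proof (rule Least_equality)
    fix e' assume "homogeneous_component e' p \<noteq> 0"
    then obtain m where "Poly_Mapping.lookup (homogeneous_component e' p) m \<noteq> 0"
      by (metis lookup_zero poly_mapping_eqI)
    then show "e \<le> e'" using assms(2)[of m] by (auto simp: lookup_homogeneous_component in_keys_iff split: if_splits)
  qed fact
  then show ?thesis by (simp add: initial_form_def)
qed

lemma initial_form_component:
  assumes "p \<noteq> 0"
  obtains e where "initial_form p = homogeneous_component e p" "\<And>m. m \<in> Poly_Mapping.keys p \<Longrightarrow> e \<le> total_degree m"
proof -
  obtain m0 where m0: "m0 \<in> Poly_Mapping.keys p" "\<And>m. m \<in> Poly_Mapping.keys p \<Longrightarrow> total_degree m0 \<le> total_degree m"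
    using assms ex_has_least_nat[of "\<lambda>m. m \<in> Poly_Mapping.keys p" _ total_degree] by (metis ex_in_conv keys_eq_empty)
  have "Poly_Mapping.lookup (homogeneous_component (total_degree m0) p) m0 \<noteq> 0"
    using m0(1) by (simp add: lookup_homogeneous_component in_keys_iff)
  then have "homogeneous_component (total_degree m0) p \<noteq> 0" by (metis lookup_zero)
  then show ?thesis using that initial_form_eqI m0(2) by blast
qed

lemma coeff_sum_homogeneous_component:
  "coeff_sum S (homogeneous_component e p) = coeff_sum (\<lambda>m. S m \<and> total_degree m = e) p"
proof -
  have "Poly_Mapping.keys (homogeneous_component e p) \<subseteq> Poly_Mapping.keys p"
    by (auto simp: in_keys_iff lookup_homogeneous_component split: if_splits)
  then show ?thesis
    by (auto simp: coeff_sum_superset[of "Poly_Mapping.keys p"] lookup_homogeneous_component intro!: sum.cong)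
qed

lemma initial_form_ideal_ideal: "ideal (initial_form_ideal I) mpoly_ring"
  unfolding initial_form_ideal_def by (intro ring.genideal_ideal cring.axioms(1) cring_mpoly_ring) simp

lemma initial_form_mem: "f \<in> I \<Longrightarrow> f \<noteq> 0 \<Longrightarrow> initial_form f \<in> initial_form_ideal I"
  unfolding initial_form_ideal_def
  by (rule subsetD[OF ring.genideal_self[OF cring.axioms(1)[OF cring_mpoly_ring]]]) auto

text \<open>Suppose a maximal term of weight \<open>k\<close> has the least degree \<open>e\<close>
  of \<open>f\<close>. Every term of \<open>f\<close> of that weight has degree at least
  \<open>e\<close>, and at most \<open>e\<close> by maximality. So the coefficient is the full sum
  over weight \<open>k\<close>, which vanishes on the toric ideal.\<close>

lemma graded_map_initial_form:
  assumes "f \<in> toric_ideal n" "f \<noteq> 0" shows "graded_map n (initial_form f) = 0"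
proof (rule poly_eqI)
  fix k
  obtain e where e: "initial_form f = homogeneous_component e f" "\<And>m. m \<in> Poly_Mapping.keys f \<Longrightarrow> e \<le> total_degree m"
    using initial_form_component assms(2) by blast
  let ?A = "{m. m \<in> Poly_Mapping.keys f \<and> (maximal n m \<and> weight n m = k) \<and> total_degree m = e}"
  have "(\<Sum>m\<in>?A. Poly_Mapping.lookup f m) = 0"
  proof (cases "?A = {}")
    case False
    then obtain m0 where m0: "maximal n m0" "weight n m0 = k" "total_degree m0 = e" by blast
    have "maximal n m \<and> total_degree m = e" if "m \<in> Poly_Mapping.keys f" "weight n m = k" for m
    proof -
      have "total_degree m = e" using e(2)[OF that(1)] m0 that(2) unfolding maximal_def by (metis le_antisym)
      then show ?thesis using m0 that maximal_cong by metis
    qed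
    then have "?A = {m. m \<in> Poly_Mapping.keys f \<and> weight n m = k}" by blast
    then have "(\<Sum>m\<in>?A. Poly_Mapping.lookup f m) = coeff (curve_map n f) k" by (simp add: coeff_curve_map coeff_sum_def)
    then show ?thesis using assms(1) by (simp add: toric_ideal_def)
  next
    case True
    then show ?thesis by (simp only: sum.empty)
  qed
  moreover have "coeff (graded_map n (initial_form f)) k = (\<Sum>m\<in>?A. Poly_Mapping.lookup f m)"
    unfolding coeff_graded_map e(1) coeff_sum_homogeneous_component unfolding coeff_sum_def ..
  ultimately show "coeff (graded_map n (initial_form f)) k = coeff 0 k" by simp
qed

lemma binomial_in_toric_ideal:
  "weight n m = weight n m' \<Longrightarrow> mon m - mon m' \<in> toric_ideal n"
  unfolding toric_ideal_def mem_Collect_eq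
  by (rule poly_eqI) (simp add: coeff_curve_map coeff_sum_minus coeff_sum_single)

lemma initial_form_binomial:
  assumes "m \<noteq> m'" "total_degree m \<le> total_degree m'"
  shows "initial_form (mon m - mon m' :: ('v :: finite, 'k :: comm_ring_1) mpoly) =
    (if total_degree m = total_degree m' then mon m - mon m' else mon m)"
proof -
  let ?p = "mon m - mon m' :: ('v, 'k) mpoly"
  have "homogeneous_component (total_degree m) ?p = (if total_degree m = total_degree m' then ?p else mon m)"
    by (rule poly_mapping_eqI) (auto simp: lookup_homogeneous_component lookup_minus lookup_single when_def)
  moreover have "initial_form ?p = homogeneous_component (total_degree m) ?p"
  proof (rule initial_form_eqI)
    have "Poly_Mapping.lookup (homogeneous_component (total_degree m) ?p) m = 1"
      using assms by (simp add: lookup_homogeneous_component lookup_minus lookup_single when_def)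
    then show "homogeneous_component (total_degree m) ?p \<noteq> 0" by (metis lookup_zero zero_neq_one)
  next
    fix k assume "k \<in> Poly_Mapping.keys ?p"
    then show "total_degree m \<le> total_degree k"
      using assms(2) by (auto simp: in_keys_iff lookup_minus lookup_single when_def split: if_splits)
  qed
  ultimately show ?thesis by simp
qed

text \<open>The kernel is an ideal containing the initial forms. Conversely, initial forms of
  binomials kill nonmaximal monomials and identify maximal ones of equal weight, which reduces each
  \<open>f\<close> to a normal form depending only on \<open>graded_map n f\<close>.\<close>

theorem initial_form_ideal_toric:
  fixes n :: "'v :: finite \<Rightarrow> nat"
  assumes pos: "\<And>i. n i > 0"
  shows "initial_form_ideal (toric_ideal n :: ('v, 'k :: field) mpoly set) = {f. graded_map n f = 0}"
proof
  have "ideal {f. graded_map n f = 0} (mpoly_ring :: ('v, 'k) mpoly ring)"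
    unfolding mpoly_ideal_iff by (auto simp: graded_map_add graded_map_mult_0)
  then show "initial_form_ideal (toric_ideal n :: ('v, 'k) mpoly set) \<subseteq> {f. graded_map n f = 0}"
    unfolding initial_form_ideal_def
    by (rule ring.genideal_minimal[OF cring.axioms(1)[OF cring_mpoly_ring]]) (auto simp: graded_map_initial_form)
next
  let ?J = "initial_form_ideal (toric_ideal n :: ('v, 'k) mpoly set)"
  have J: "0 \<in> ?J" "\<And>f g. f \<in> ?J \<Longrightarrow> g \<in> ?J \<Longrightarrow> f + g \<in> ?J" "\<And>f g. f \<in> ?J \<Longrightarrow> g * f \<in> ?J"
    using initial_form_ideal_ideal[of "toric_ideal n :: ('v, 'k) mpoly set"] unfolding mpoly_ideal_iff by simp_all
  have ini: "initial_form (mon m - mon m') \<in> ?J" if "weight n m = weight n m'" "m \<noteq> m'" for m m'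
  proof (rule initial_form_mem[OF binomial_in_toric_ideal[OF that(1)]])
    show "mon m - mon m' \<noteq> (0 :: ('v, 'k) mpoly)"  using that(2) by (simp add: mon_eq_iff)
  qed
  have nonmax: "mon m \<in> ?J" if nm: "\<not> maximal n m" for m
  proof -
    obtain m' where m': "weight n m' = weight n m" "total_degree m < total_degree m'"
      using nm unfolding maximal_def by (meson not_le)
    then have "m \<noteq> m'" by auto
    then show ?thesis using ini[of m m'] m' by (simp add: initial_form_binomial)
  qed
  have same: "mon m - mon m' \<in> ?J" if "maximal n m" "maximal n m'" "weight n m = weight n m'" for m m'
  proof (cases "m = m'")
    case False
    then show ?thesis
      using ini[of m m'] that maximal_total_degree_eq[OF that] by (simp add: initial_form_binomial)
  qed (simp add: J)
  \<comment> \<open>\<open>\<rho>\<close> picks one maximal exponent in each weight that has one;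
    \<open>F\<close> below turns an image in K[t] back into a combination of these
    representatives.\<close>
  have "\<forall>w. \<exists>m0. \<forall>m. maximal n m \<and> weight n m = w \<longrightarrow> maximal n m0 \<and> weight n m0 = w" by blast
  then obtain \<rho> where "\<forall>w m. maximal n m \<and> weight n m = w \<longrightarrow> maximal n (\<rho> w) \<and> weight n (\<rho> w) = w"
    by (drule_tac choice) blast
  then have \<rho>: "maximal n m \<Longrightarrow> maximal n (\<rho> (weight n m)) \<and> weight n (\<rho> (weight n m)) = weight n m" for m
    by blast
  define F where "F g = (\<Sum>k\<le>degree g. Poly_Mapping.single (\<rho> k) (coeff g k))" for g :: "'k poly"
  have F: "F g = (\<Sum>k\<le>N. Poly_Mapping.single (\<rho> k) (coeff g k))" if "degree g \<le> N" for g N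
    unfolding F_def using that by (intro sum.mono_neutral_left) (auto simp: coeff_eq_0)
  have F_add: "F (g + h) = F g + F h" for g h
  proof -
    let ?N = "max (degree g) (degree h)"
    have "F (g + h) = (\<Sum>k\<le>?N. Poly_Mapping.single (\<rho> k) (coeff (g + h) k))"
      by (rule F) (rule degree_add_le, auto)
    also have "\<dots> = F g + F h" by (simp add: F[of _ ?N] single_add sum.distrib)
    finally show ?thesis .
  qed
  have F_monom: "F (Polynomial.monom c k) = Poly_Mapping.single (\<rho> k) c" for c k
  proof -
    have "F (Polynomial.monom c k) = (\<Sum>j\<le>k. if k = j then Poly_Mapping.single (\<rho> k) c else 0)"
      unfolding F[OF degree_monom_le] by (rule sum.cong) auto
    then show ?thesis by simp
  qed
  have "f - F (graded_map n f) \<in> ?J" for f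
  proof (induction f rule: mpoly_induct)
    case zero
    then show ?case by (simp add: F_def J)
  next
    case (add m c f)
    have "Poly_Mapping.single m c - F (graded_map n (Poly_Mapping.single m c)) \<in> ?J"
    proof (cases "maximal n m")
      case True
      have "Poly_Mapping.single m c - F (graded_map n (Poly_Mapping.single m c)) =
          Poly_Mapping.single 0 c * (mon m - mon (\<rho> (weight n m)))"
        using True by (simp add: graded_map_single F_monom right_diff_distrib mult_single)
      then show ?thesis using J(3) same[of m "\<rho> (weight n m)"] \<rho>[OF True] True by metis
    next
      case False
      have "Poly_Mapping.single m c - F (graded_map n (Poly_Mapping.single m c)) = Poly_Mapping.single 0 c * mon m"
        using False by (simp add: graded_map_single F_def mult_single)
      then show ?thesis using J(3) nonmax[OF False] by metis
    qed
    then have "(Poly_Mapping.single m c - F (graded_map n (Poly_Mapping.single m c))) + (f - F (graded_map n f)) \<in> ?J"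
      using add J(2) by blast
    then show ?case by (simp add: graded_map_add F_add algebra_simps)
  qed
  then have "f - F 0 \<in> ?J" if "graded_map n f = 0" for f using that by metis
  then show "{f. graded_map n f = 0} \<subseteq> ?J" by (auto simp: F_def)
qed

section \<open>Cohen--Macaulay tangent cones of monomial curves\<close>

definition line_embedding :: "'v \<Rightarrow> 'k :: comm_ring_1 poly \<Rightarrow> ('v, 'k) mpoly" where
  "line_embedding i g = poly (map_poly (Poly_Mapping.single 0) g) (var i)"

lemma line_embedding_zero [simp]: "line_embedding i 0 = 0"
  by (simp add: line_embedding_def)

lemma line_embedding_pCons:
  "line_embedding i (pCons c g) = Poly_Mapping.single 0 c + var i * line_embedding i g"
  by (simp add: line_embedding_def map_poly_pCons)

lemma line_embedding_one: "line_embedding i 1 = 1"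
  by (simp add: one_pCons line_embedding_pCons)

lemma line_embedding_var: "line_embedding i [:0, 1:] = var i"
  by (simp add: line_embedding_pCons)

lemma line_embedding_add: "line_embedding i (g + h) = line_embedding i g + line_embedding i h"
  by (induction g h rule: poly_induct2) (simp_all add: line_embedding_pCons single_add algebra_simps)

lemma line_embedding_smult: "line_embedding i (Polynomial.smult c g) = Poly_Mapping.single 0 c * line_embedding i g"
  by (induction g) (simp_all add: line_embedding_pCons distrib_left mult_single ac_simps)

lemma line_embedding_mult: "line_embedding i (g * h) = line_embedding i g * line_embedding i h"
  by (induction g) (simp_all add: line_embedding_pCons mult_pCons_left line_embedding_add line_embedding_smult algebra_simps)

lemma line_embedding_power: "line_embedding i (g ^ k) = line_embedding i g ^ k"
  by (induction k) (simp_all add: line_embedding_one line_embedding_mult)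

lemma line_embedding_monom: "line_embedding i (Polynomial.monom c k) = Poly_Mapping.single (Poly_Mapping.single i k) c"
  by (induction k) (simp_all add: monom_0 monom_Suc line_embedding_pCons var_def mult_single flip: single_add)

lemma mon_power: "mon m ^ k = (mon (Poly_Mapping.map ((*) k) m) :: ('v, 'k :: comm_ring_1) mpoly)"
proof (induction k)
  case 0
  have "Poly_Mapping.map ((*) 0) m = (0 :: 'v \<Rightarrow>\<^sub>0 nat)"
    by (rule poly_mapping_eqI) (simp add: Poly_Mapping.map.rep_eq when_def)
  then show ?case by (simp only: power_0 single_one)
next
  case (Suc k)
  have "Poly_Mapping.map ((*) (Suc k)) m = m + Poly_Mapping.map ((*) k) m"
    by (rule poly_mapping_eqI) (simp add: Poly_Mapping.map.rep_eq when_def lookup_add)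
  then show ?case using Suc by (simp only: power_Suc mult_single mult_1)
qed

lemma weight_scale: "weight n (Poly_Mapping.map ((*) k) m) = k * weight n m"
proof -
  have "Poly_Mapping.lookup (Poly_Mapping.map ((*) k) m) i = k * Poly_Mapping.lookup m i" for i
    by (simp add: Poly_Mapping.map.rep_eq when_def)
  then show ?thesis by (simp add: weight_def sum_distrib_left ac_simps)
qed

lemma total_degree_scale: "total_degree (Poly_Mapping.map ((*) k) m) = k * total_degree m"
proof -
  have "Poly_Mapping.lookup (Poly_Mapping.map ((*) k) m) i = k * Poly_Mapping.lookup m i" for i
    by (simp add: Poly_Mapping.map.rep_eq when_def)
  then show ?thesis by (simp add: total_degree_def sum_distrib_left)
qed

section \<open>Curves with a distinguished variable of least weight\<close>

locale monomial_curve =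
  fixes n :: "'v :: finite \<Rightarrow> nat" and i0 :: 'v
  assumes pos: "n i > 0" and min: "n i0 \<le> n i"
begin

lemma weight_ge: "n i0 * total_degree m \<le> weight n m"
  unfolding weight_def total_degree_def sum_distrib_left by (intro sum_mono mult_right_mono min) simp

text \<open>Powers of the lightest variable attain the bound of \<open>weight_ge\<close>.\<close>

lemma maximal_single_min: "maximal n (Poly_Mapping.single i0 k)"
  unfolding maximal_def using weight_ge pos[of i0] by (metis mult_le_cancel1 total_degree_single weight_single)

text \<open>The power of the lightest variable with exponent \<open>weight n m\<close> beats the
  \<open>n i0\<close>-th power of a monomial that involves a heavier variable.\<close>

lemma not_maximal_power:
  assumes "Poly_Mapping.lookup m i > 0" "n i0 < n i"
  shows "\<exists>m'. weight n m' = n i0 * weight n m \<and> total_degree m' > n i0 * total_degree m"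
proof (intro exI conjI)
  let ?m = "Poly_Mapping.single i0 (weight n m)"
  show "weight n ?m = n i0 * weight n m" by simp
  have "(\<Sum>j\<in>UNIV. n i0 * Poly_Mapping.lookup m j) < (\<Sum>j\<in>UNIV. n j * Poly_Mapping.lookup m j)"
    using assms by (intro sum_strict_mono_ex1) (auto intro: mult_right_mono min)
  then have "n i0 * total_degree m < weight n m"
    by (simp add: weight_def total_degree_def sum_distrib_left)
  then show "total_degree ?m > n i0 * total_degree m" by simp
qed

text \<open>Several entries may attain the minimum. A monomial in such variables only has the weight
  of a power of x_i0 of the same degree; one with a heavier variable will be nilpotent in the
  tangent cone.\<close>

lemma weight_total_degree_cases:
  obtains (tie) "weight n m = n i0 * total_degree m"
  | (greater) i where "Poly_Mapping.lookup m i > 0" "n i0 < n i"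
proof (cases "\<exists>i. Poly_Mapping.lookup m i > 0 \<and> n i0 < n i")
  case False
  have "n i * Poly_Mapping.lookup m i = n i0 * Poly_Mapping.lookup m i" for i
    using False min[of i] by (metis le_antisym mult_0_right neq0_conv not_less)
  then have "weight n m = n i0 * total_degree m"
    unfolding weight_def total_degree_def sum_distrib_left by (intro sum.cong refl)
  then show ?thesis by (rule that)
qed (use that in blast)

lemma graded_map_mon_power_eq_0:
  assumes "Poly_Mapping.lookup m i > 0" "n i0 < n i"
  shows "graded_map n (mon m ^ n i0 :: ('v, 'k :: comm_ring_1) mpoly) = 0"
proof -
  obtain m' where "weight n m' = n i0 * weight n m" "total_degree m' > n i0 * total_degree m"
    using not_maximal_power[OF assms] by blast
  then have "\<not> maximal n (Poly_Mapping.map ((*) (n i0)) m)"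
    by (intro not_maximalI[of _ m']) (simp_all add: weight_scale total_degree_scale)
  then show ?thesis by (simp add: mon_power graded_map_single)
qed

text \<open>The monomial factor serves the induction: splitting off a constant term raises
  \<open>j\<close> by one.\<close>

lemma graded_map_line_embedding:
  "graded_map n (mon (Poly_Mapping.single i0 j) * line_embedding i0 g) =
    (Polynomial.monom 1 (n i0 * j) * pcompose g (Polynomial.monom 1 (n i0)) :: 'k :: comm_ring_1 poly)"
proof (induction g arbitrary: j)
  case (pCons c g)
  have "graded_map n (mon (Poly_Mapping.single i0 j) * line_embedding i0 (pCons c g)) =
      graded_map n (Poly_Mapping.single (Poly_Mapping.single i0 j) c) +
      graded_map n (mon (Poly_Mapping.single i0 (Suc j)) * line_embedding i0 g)"
  proof -
    have "mon (Poly_Mapping.single i0 j) * line_embedding i0 (pCons c g) =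
      Poly_Mapping.single (Poly_Mapping.single i0 j) c + mon (Poly_Mapping.single i0 (Suc j)) * line_embedding i0 g"
      by (simp add: line_embedding_pCons distrib_left mult_single var_def mult.assoc[symmetric] flip: single_add)
    then show ?thesis by (simp add: graded_map_add)
  qed
  then show ?case
    by (simp add: pCons graded_map_single maximal_single_min pcompose_pCons distrib_left mult_monom
        mult.assoc[symmetric] add.commute) (simp add: monom_altdef ac_simps)
qed simp

text \<open>With \<open>maximal_addD\<close>, the assumption makes maximality of a monomial and of
  its product with x_i0 equivalent, so only weights shift.\<close>

lemma graded_map_var_mult:
  assumes "\<And>m. maximal n m \<Longrightarrow> maximal n (Poly_Mapping.single i0 1 + m)"
  shows "graded_map n (var i0 * f) = Polynomial.monom 1 (n i0) * graded_map n f"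
proof (rule poly_eqI)
  fix k
  have "maximal n (Poly_Mapping.single i0 1 + m) \<and> weight n (Poly_Mapping.single i0 1 + m) = k \<longleftrightarrow>
      n i0 \<le> k \<and> maximal n m \<and> weight n m = k - n i0" for m
    using assms[of m] maximal_addD[of n "Poly_Mapping.single i0 1" m] by (auto simp: weight_add)
  then show "coeff (graded_map n (var i0 * f)) k = coeff (Polynomial.monom 1 (n i0) * graded_map n f) k"
    unfolding var_def coeff_graded_map coeff_sum_mult_single coeff_monom_mult
    by (auto simp: coeff_graded_map not_less) (simp add: coeff_sum_def)
qed

lemma graded_map_line_embedding_mult:
  assumes "\<And>m. maximal n m \<Longrightarrow> maximal n (Poly_Mapping.single i0 1 + m)"
  shows "graded_map n (line_embedding i0 g * f) = pcompose g (Polynomial.monom 1 (n i0)) * graded_map n f"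
proof (induction g)
  case (pCons c g)
  have "graded_map n (Poly_Mapping.single 0 c * f) = Polynomial.smult c (graded_map n f)"
    by (rule poly_eqI) (simp add: coeff_graded_map coeff_sum_mult_single)
  then show ?case
    by (simp add: line_embedding_pCons distrib_right mult.assoc graded_map_add graded_map_var_mult[OF assms]
        pCons.IH pcompose_pCons)
qed simp

section \<open>The tangent cone ring as a line plus its nilradical\<close>

context
  fixes J and N :: "('v, 'k :: field) mpoly set" and R
  defines "J \<equiv> initial_form_ideal (toric_ideal n :: ('v, 'k) mpoly set)"
    and "N \<equiv> {f. \<exists>k. f ^ k \<in> J}"
    and "R \<equiv> mpoly_ring Quot J"
begin

lemma J_iff: "f \<in> J \<longleftrightarrow> graded_map n f = 0"
  unfolding J_def by (simp add: initial_form_ideal_toric pos)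

lemma J_ideal: "ideal J mpoly_ring"
  unfolding J_def by (rule initial_form_ideal_ideal)

lemma J_closed: "0 \<in> J" "f \<in> J \<Longrightarrow> g \<in> J \<Longrightarrow> f + g \<in> J" "f \<in> J \<Longrightarrow> h * f \<in> J"
  using J_ideal unfolding mpoly_ideal_iff by simp_all

lemma N_ideal: "ideal N (mpoly_ring :: ('v, 'k) mpoly ring)"
  unfolding mpoly_ideal_iff
proof (intro conjI ballI allI)
  show "0 \<in> N" unfolding N_def using J_closed(1) by (auto intro: exI[of _ 1])
next
  fix f g assume "f \<in> N" "g \<in> N"
  then obtain k l where kl: "f ^ k \<in> J" "g ^ l \<in> J" unfolding N_def by blast
  \<comment> \<open>In each binomial term either \<open>f\<close> has exponent at least
    \<open>k\<close> or \<open>g\<close> has exponent at least \<open>l\<close>.\<close>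
  have summand: "of_nat ((k + l) choose i) * f ^ i * g ^ (k + l - i) \<in> J" for i
  proof (cases "k \<le> i")
    case True
    then have "f ^ i = f ^ (i - k) * f ^ k" by (simp flip: power_add)
    then have "of_nat ((k + l) choose i) * f ^ i * g ^ (k + l - i) = (of_nat ((k + l) choose i) * f ^ (i - k) * g ^ (k + l - i)) * f ^ k"
      by (simp add: ac_simps)
    then show ?thesis using J_closed(3)[OF kl(1)] by simp
  next
    case False
    then have "g ^ (k + l - i) = g ^ (k - i) * g ^ l" by (simp flip: power_add)
    then have "of_nat ((k + l) choose i) * f ^ i * g ^ (k + l - i) = (of_nat ((k + l) choose i) * f ^ i * g ^ (k - i)) * g ^ l"
      by (simp add: ac_simps)
    then show ?thesis using J_closed(3)[OF kl(2)] by simp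
  qed
  have "(\<Sum>i\<in>A. of_nat ((k + l) choose i) * f ^ i * g ^ (k + l - i)) \<in> J" if "finite A" for A
    using that by (induction A rule: finite_induct) (simp_all add: J_closed summand)
  then have "(f + g) ^ (k + l) \<in> J" unfolding binomial_ring by simp
  then show "f + g \<in> N" unfolding N_def by blast
next
  fix f g assume "f \<in> N"
  then obtain k where "f ^ k \<in> J" unfolding N_def by blast
  then have "(g * f) ^ k \<in> J" using J_closed(3) by (simp add: power_mult_distrib)
  then show "g * f \<in> N" unfolding N_def by blast
qed

lemma J_subset_N: "J \<subseteq> N"
  unfolding N_def by (auto intro: exI[of _ 1])

lemma line_embedding_N: "line_embedding i0 g \<in> N \<Longrightarrow> g = 0"
proof -
  assume "line_embedding i0 g \<in> N"
  then obtain k where "line_embedding i0 (g ^ k) \<in> J" unfolding N_def by (auto simp: line_embedding_power)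
  then have "pcompose (g ^ k) (Polynomial.monom 1 (n i0)) = 0"
    using graded_map_line_embedding[of 0 "g ^ k"] by (simp add: J_iff monom_0)
  then show "g = 0" using pcompose_monom_eq_0_iff[OF pos, of "g ^ k" i0] by simp
qed

text \<open>Modulo \<open>J\<close>, a monomial in variables of least weight equals a power of x_i0;
  every other monomial is nilpotent.\<close>

lemma N_decomp: "\<exists>g. f - line_embedding i0 g \<in> N"
proof (induction f rule: mpoly_induct)
  case zero
  have "0 - line_embedding i0 0 \<in> N" using J_closed(1) J_subset_N by auto
  then show ?case by blast
next
  case (add m c f)
  have "\<exists>g. Poly_Mapping.single m c - line_embedding i0 g \<in> N"
  proof (cases rule: weight_total_degree_cases[of m])
    case tie
    have "maximal n m = maximal n (Poly_Mapping.single i0 (total_degree m))"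
      by (rule maximal_cong) (simp_all add: tie)
    then have "Poly_Mapping.single m c - line_embedding i0 (Polynomial.monom c (total_degree m)) \<in> J"
      by (simp add: J_iff graded_map_minus line_embedding_monom graded_map_single tie)
    then show ?thesis using J_subset_N by blast
  next
    case (greater i)
    have "mon m ^ n i0 \<in> J" unfolding J_iff by (rule graded_map_mon_power_eq_0[OF greater])
    then have "mon m \<in> N" unfolding N_def by blast
    moreover have "Poly_Mapping.single m c - line_embedding i0 0 = Poly_Mapping.single 0 c * mon m"
      by (simp add: mult_single)
    ultimately show ?thesis using N_ideal unfolding mpoly_ideal_iff by metis
  qed
  then obtain g h where "Poly_Mapping.single m c - line_embedding i0 g \<in> N" "f - line_embedding i0 h \<in> N"
    using add by blast
  then have "(Poly_Mapping.single m c - line_embedding i0 g) + (f - line_embedding i0 h) \<in> N"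
    using N_ideal unfolding mpoly_ideal_iff by blast
  then have "Poly_Mapping.single m c + f - line_embedding i0 (g + h) \<in> N"
    by (simp add: line_embedding_add algebra_simps)
  then show ?case by blast
qed

definition coset :: "('v, 'k) mpoly \<Rightarrow> ('v, 'k) mpoly set" where
  "coset f = J +>\<^bsub>mpoly_ring\<^esub> f"

lemma coset_mem: "h \<in> coset f \<longleftrightarrow> h - f \<in> J"
proof -
  have "h \<in> coset f \<longleftrightarrow> (\<exists>j\<in>J. h = j + f)" unfolding coset_def a_r_coset_def' by auto
  also have "\<dots> \<longleftrightarrow> h - f \<in> J" by (metis add_diff_cancel diff_add_cancel)
  finally show ?thesis .
qed

lemma coset_eq_iff: "coset f = coset g \<longleftrightarrow> f - g \<in> J"
proof
  assume "coset f = coset g"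
  then show "f - g \<in> J" using coset_mem[of f f] coset_mem[of f g] J_closed(1) by simp
next
  assume fg: "f - g \<in> J"
  show "coset f = coset g"
  proof (rule Set.set_eqI)
    fix h
    have "h - g = (h - f) + (f - g)" "h - f = (h - g) - (f - g)" by simp_all
    then show "h \<in> coset f \<longleftrightarrow> h \<in> coset g"
      unfolding coset_mem using fg J_closed(2) mpoly_ideal_minus[OF J_ideal] by metis
  qed
qed

lemma R_cring: "cring R"
  unfolding R_def by (rule ideal.quotient_is_cring[OF J_ideal cring_mpoly_ring])

lemma coset_hom:
  "coset (f + g) = coset f \<oplus>\<^bsub>R\<^esub> coset g" "coset (f * g) = coset f \<otimes>\<^bsub>R\<^esub> coset g" "coset 1 = \<one>\<^bsub>R\<^esub>" "coset f \<in> carrier R"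
  using ring_hom_add[OF ideal.rcos_ring_hom[OF J_ideal], of f g] ring_hom_mult[OF ideal.rcos_ring_hom[OF J_ideal], of f g]
    ring_hom_one[OF ideal.rcos_ring_hom[OF J_ideal]] ring_hom_closed[OF ideal.rcos_ring_hom[OF J_ideal], of f]
  by (simp_all add: coset_def R_def)

lemma carrier_R: "r \<in> carrier R \<Longrightarrow> \<exists>f. r = coset f"
  unfolding R_def coset_def FactRing_def A_RCOSETS_def' by auto

lemma coset_zero: "coset 0 = \<zero>\<^bsub>R\<^esub>"
proof -
  interpret R: cring R by (rule R_cring)
  have "coset 0 \<oplus>\<^bsub>R\<^esub> coset 0 = coset 0" by (simp flip: coset_hom)
  then show ?thesis using coset_hom(4)[of 0] by simp
qed

lemma coset_eq_zero: "coset f = \<zero>\<^bsub>R\<^esub> \<longleftrightarrow> f \<in> J"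
  using coset_eq_iff[of f 0] by (simp add: coset_zero)

lemma coset_minus: "coset (f - g) = coset f \<ominus>\<^bsub>R\<^esub> coset g"
proof -
  interpret R: cring R by (rule R_cring)
  have "coset (f - g) \<oplus>\<^bsub>R\<^esub> coset g = coset f" by (simp flip: coset_hom)
  moreover have "coset (f - g) = (coset (f - g) \<oplus>\<^bsub>R\<^esub> coset g) \<ominus>\<^bsub>R\<^esub> coset g"
    using coset_hom(4)[of "f - g"] coset_hom(4)[of g] by (simp add: a_minus_def R.a_assoc R.r_neg)
  ultimately show ?thesis by simp
qed

lemma coset_power: "coset (f ^ k) = coset f [^]\<^bsub>R\<^esub> (k :: nat)"
proof -
  interpret R: cring R by (rule R_cring)
  show ?thesis by (induction k) (simp_all add: coset_hom R.m_comm)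
qed

lemma line_plus_nil_R: "line_plus_nil R (\<lambda>g. coset (line_embedding i0 g)) (coset ` N)"
proof -
  interpret R: cring R by (rule R_cring)
  have N: "0 \<in> N" "\<And>f g. f \<in> N \<Longrightarrow> g \<in> N \<Longrightarrow> f + g \<in> N" "\<And>f g. f \<in> N \<Longrightarrow> g * f \<in> N"
    using N_ideal unfolding mpoly_ideal_iff by simp_all
  show ?thesis
  proof (intro line_plus_nil.intro line_plus_nil_axioms.intro R_cring)
    show "ideal (coset ` N) R"
    proof (rule R.idealI_cring)
      show "\<zero>\<^bsub>R\<^esub> \<in> coset ` N" unfolding coset_zero[symmetric] using N(1) by blast
    next
      fix a b assume "a \<in> coset ` N" "b \<in> coset ` N"
      then obtain f g where "f \<in> N" "g \<in> N" "a = coset f" "b = coset g" by blast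
      then show "a \<oplus>\<^bsub>R\<^esub> b \<in> coset ` N" using N(2) by (metis coset_hom(1) imageI)
    next
      fix a x assume "a \<in> coset ` N" "x \<in> carrier R"
      then obtain f g where "f \<in> N" "a = coset f" "x = coset g" using carrier_R by blast
      then show "x \<otimes>\<^bsub>R\<^esub> a \<in> coset ` N" using N(3) by (metis coset_hom(2) imageI)
    qed (use coset_hom(4) in auto)
  next
    fix \<nu> assume "\<nu> \<in> coset ` N"
    then obtain f k where "\<nu> = coset f" "f ^ k \<in> J" unfolding N_def by blast
    then have "\<nu> [^]\<^bsub>R\<^esub> k = \<zero>\<^bsub>R\<^esub>" by (simp add: coset_eq_zero flip: coset_power)
    then show "\<exists>k::nat. \<nu> [^]\<^bsub>R\<^esub> k = \<zero>\<^bsub>R\<^esub>" by blast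
  next
    fix g assume "coset (line_embedding i0 g) \<in> coset ` N"
    then obtain f where f: "f \<in> N" "line_embedding i0 g - f \<in> J" using coset_eq_iff by blast
    then have "(line_embedding i0 g - f) + f \<in> N" using J_subset_N N(2) by blast
    then show "g = 0" using line_embedding_N by simp
  next
    fix r assume "r \<in> carrier R"
    then obtain f where f: "r = coset f" using carrier_R by blast
    obtain g where "f - line_embedding i0 g \<in> N" using N_decomp by blast
    then show "\<exists>g. r \<ominus>\<^bsub>R\<^esub> coset (line_embedding i0 g) \<in> coset ` N"
      unfolding f coset_minus[symmetric] by blast
  qed (simp_all add: coset_hom line_embedding_add line_embedding_mult line_embedding_one)
qed

lemma weighted_line_plus_nil_R:
  assumes P: "\<And>m. maximal n m \<Longrightarrow> maximal n (Poly_Mapping.single i0 1 + m)"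
  shows "weighted_line_plus_nil R (\<lambda>g. coset (line_embedding i0 g)) (coset ` N)
    (\<lambda>r. graded_map n (SOME f. r = coset f)) (n i0)"
proof -
  interpret line_plus_nil R "\<lambda>g. coset (line_embedding i0 g)" "coset ` N" by (rule line_plus_nil_R)
  \<comment> \<open>The chosen representative does not matter, since \<open>J\<close> is the kernel
    of \<open>graded_map n\<close>.\<close>
  have \<Lambda>: "graded_map n (SOME h. coset f = coset h) = graded_map n f" for f
  proof -
    have "coset f = coset (SOME h. coset f = coset h)" by (rule someI[of _ f]) simp
    then have "f - (SOME h. coset f = coset h) \<in> J" by (simp only: coset_eq_iff)
    then show ?thesis by (simp add: J_iff graded_map_minus)
  qed
  show ?thesis
  proof (intro weighted_line_plus_nil.intro weighted_line_plus_nil_axioms.intro line_plus_nil_R)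
    show "n i0 > 0" by (rule pos)
  next
    fix a b assume "a \<in> carrier R" "b \<in> carrier R"
    then obtain f g where "a = coset f" "b = coset g" using carrier_R by blast
    then show "graded_map n (SOME f. a \<oplus>\<^bsub>R\<^esub> b = coset f) =
        graded_map n (SOME f. a = coset f) + graded_map n (SOME f. b = coset f)"
      by (simp add: \<Lambda> graded_map_add flip: coset_hom)
  next
    fix a g assume "a \<in> carrier R"
    then obtain f where "a = coset f" using carrier_R by blast
    then show "graded_map n (SOME f. coset (line_embedding i0 g) \<otimes>\<^bsub>R\<^esub> a = coset f) =
        pcompose g (Polynomial.monom 1 (n i0)) * graded_map n (SOME f. a = coset f)"
      by (simp add: \<Lambda> graded_map_line_embedding_mult[OF P] flip: coset_hom)
  next
    fix a assume "a \<in> carrier R" and z: "graded_map n (SOME f. a = coset f) = 0"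
    then obtain f where "a = coset f" using carrier_R by blast
    then show "a = \<zero>\<^bsub>R\<^esub>" using z by (simp add: \<Lambda> coset_eq_zero J_iff)
  qed
qed

end

text \<open>If x_i0 destroys maximality of \<open>m\<close>, it annihilates the nonzero class of
  \<open>mon m\<close>, against \<open>cohen_macaulay_imp_regular\<close>. If it never does,
  \<open>graded_map\<close> supplies the torsion-free embedding.\<close>

theorem cm_tangent_cone_iff:
  "cm_tangent_cone TYPE('k :: field) n \<longleftrightarrow>
    (\<forall>m. maximal n m \<longrightarrow> maximal n (Poly_Mapping.single i0 1 + m))"
proof
  assume CM: "cm_tangent_cone TYPE('k) n"
  interpret line_plus_nil "mpoly_ring Quot initial_form_ideal (toric_ideal n :: ('v, 'k) mpoly set)"
      "\<lambda>g. coset (line_embedding i0 g)"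
      "coset ` {f. \<exists>k. f ^ k \<in> initial_form_ideal (toric_ideal n :: ('v, 'k) mpoly set)}"
    by (rule line_plus_nil_R)
  show "\<forall>m. maximal n m \<longrightarrow> maximal n (Poly_Mapping.single i0 1 + m)"
  proof (intro allI impI, rule ccontr)
    fix m assume m: "maximal n m" "\<not> maximal n (Poly_Mapping.single i0 1 + m)"
    have "coset (var i0 * mon m) = \<zero>\<^bsub>mpoly_ring Quot initial_form_ideal (toric_ideal n :: ('v, 'k) mpoly set)\<^esub>"
      unfolding coset_eq_zero J_iff var_def by (simp add: mult_single graded_map_single m(2) del: One_nat_def)
    then have "coset (mon m) = \<zero>\<^bsub>mpoly_ring Quot initial_form_ideal (toric_ideal n :: ('v, 'k) mpoly set)\<^esub>"
      using CM cohen_macaulay_imp_regular[of "coset (mon m)"]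
      by (simp add: cm_tangent_cone_def line_embedding_var coset_hom)
    then show False using m(1) by (simp add: coset_eq_zero J_iff graded_map_single monom_eq_0_iff)
  qed
next
  assume P: "\<forall>m. maximal n m \<longrightarrow> maximal n (Poly_Mapping.single i0 1 + m)"
  show "cm_tangent_cone TYPE('k) n"
    unfolding cm_tangent_cone_def
    by (rule weighted_line_plus_nil.cohen_macaulay[OF weighted_line_plus_nil_R]) (use P in blast)
qed

end

section \<open>Glued semigroups\<close>

lemma coprime_linear_eq:
  fixes a b :: nat
  assumes "coprime a b" "b * x = a * y1 + b * y2" "x < a" "b > 0"
  shows "y1 = 0 \<and> y2 = x"
proof -
  have le: "y2 \<le> x" using assms(2,4) by (metis le_add2 mult_le_cancel1)
  have eq: "b * (x - y2) = a * y1" using assms(2) by (simp add: diff_mult_distrib2)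
  then have "a dvd b * (x - y2)" by simp
  then have "a dvd x - y2" using assms(1) by (simp add: coprime_dvd_mult_right_iff)
  then have "x - y2 = 0" using assms(3) by (meson dvd_imp_le le_less_trans less_imp_diff_less linorder_not_le neq0_conv)
  then have "y2 = x" using le by simp
  then show ?thesis using eq assms(3) by simp
qed

lemma coprime_linear_eq':
  fixes a b :: nat
  assumes "coprime a b" "b * x + a * y = b * x' + a * y'" "x < a" "x' < a" "b > 0"
  shows "x = x' \<and> y = y'"
proof -
  have "x = x' \<and> y = y'"
    if "coprime a b" "b * x + a * y = b * x' + a * y'" "x < a" "b > 0" "y \<le> y'" for x x' y y' :: nat
  proof -
    have "b * x = a * (y' - y) + b * x'" using that(2,5) by (simp add: diff_mult_distrib2)
    then have "y' - y = 0 \<and> x' = x" using coprime_linear_eq[of a b x "y' - y" x'] that by blast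
    then show ?thesis using that(5) by simp
  qed
  from this[of x y x' y'] this[of x' y' x y] show ?thesis
    using assms by (metis nat_le_linear)
qed

text \<open>Two representations differ by a multiple of (q, -p); the cases record its sign, as
  subtraction in the naturals truncates.\<close>

lemma coprime_exchange [consumes 4, case_names down up]:
  fixes p q :: nat
  assumes "coprime p q" "p * A + q * B = p * A' + q * B'" "p > 0" "q > 0"
  obtains (down) k where "A = A' + q * k" "B' = B + p * k"
  | (up) k where "k > 0" "A' = A + q * k" "B = B' + p * k"
proof -
  have *: "\<exists>k. A = A' + q * k \<and> B' = B + p * k"
    if "p * A + q * B = p * A' + q * B'" "A' \<le> A" for A B A' B'
  proof -
    have "p * A' \<le> p * A" using that(2) by simp
    then have eq: "p * (A - A') + q * B = q * B'" using that by (simp add: diff_mult_distrib2)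
    then have "q dvd p * (A - A')" by (metis dvd_add_left_iff dvd_triv_left)
    then have "q dvd A - A'" using assms(1) by (simp add: coprime_commute coprime_dvd_mult_right_iff)
    then obtain k where k: "A - A' = q * k" by (elim dvdE)
    then have "q * (p * k + B) = q * B'" using eq by (simp add: algebra_simps)
    then have "B' = B + p * k" using assms(4) by simp
    then show ?thesis using k that(2) by (metis le_add_diff_inverse)
  qed
  show ?thesis
  proof (cases "A' \<le> A")
    case True
    then show ?thesis using *[of A B A' B'] assms(2) down by blast
  next
    case False
    then obtain k where k: "A' = A + q * k" "B = B' + p * k" using *[of A' B' A B] assms(2) by auto
    then have "k > 0" using False by (cases k) auto
    then show ?thesis using k up by blast
  qed
qed

section \<open>Exponent vectors in four variables and the gluing\<close>

definition exponents :: "nat \<Rightarrow> nat \<Rightarrow> nat \<Rightarrow> nat \<Rightarrow> 4 \<Rightarrow>\<^sub>0 nat" where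
  "exponents a b c d = Poly_Mapping.single 1 a + Poly_Mapping.single 2 b + Poly_Mapping.single 3 c + Poly_Mapping.single 4 d"

lemma exponents_exhaust: "\<exists>a b c d. m = exponents a b c d"
proof (intro exI, rule poly_mapping_eqI)
  fix i :: 4
  have "i \<in> {1, 2, 3, 4}" using UNIV_4 by blast
  then show "Poly_Mapping.lookup m i = Poly_Mapping.lookup (exponents (Poly_Mapping.lookup m 1)
      (Poly_Mapping.lookup m 2) (Poly_Mapping.lookup m 3) (Poly_Mapping.lookup m 4)) i"
    by (auto simp: exponents_def lookup_add lookup_single)
qed

lemma weight_exponents: "weight n (exponents a b c d) = n 1 * a + n 2 * b + n 3 * c + n 4 * d"
  by (simp add: exponents_def weight_add)

lemma total_degree_exponents: "total_degree (exponents a b c d) = a + b + c + d"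
  by (simp add: exponents_def total_degree_add)

lemma exponents_add: "Poly_Mapping.single 1 k + exponents a b c d = exponents (k + a) b c d"
  by (simp add: exponents_def single_add ac_simps)

lemma maximal_exponents:
  "maximal n (exponents a b c d) \<longleftrightarrow> (\<forall>a' b' c' d'.
    n 1 * a' + n 2 * b' + n 3 * c' + n 4 * d' = n 1 * a + n 2 * b + n 3 * c + n 4 * d \<longrightarrow>
    a' + b' + c' + d' \<le> a + b + c + d)"
  unfolding maximal_def by (metis exponents_exhaust weight_exponents total_degree_exponents)

text \<open>The semigroup is glued from p<a2, a1> and q<a4, a3>. Both sides of the relation between
  x1^u1 x2^u2 and x3^u3 x4^u4 have weight p q. The bounds on \<open>u2\<close> and \<open>u3\<close>
  normalise it modulo the relations x1^a1 = x2^a2 and x3^a3 = x4^a4.\<close>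

locale gluing =
  fixes n :: "4 \<Rightarrow> nat" and a1 a2 a3 a4 u1 u2 u3 u4 p q :: nat
  assumes a_pos: "a1 > 0" "a2 > 0" "a3 > 0" "a4 > 0"
    and coprime12: "coprime a2 a1" and coprime34: "coprime a3 a4" and coprime_pq: "coprime p q"
    and n_eq: "n 1 = a2 * p" "n 2 = a1 * p" "n 3 = a4 * q" "n 4 = a3 * q"
    and p_eq: "p = a4 * u3 + a3 * u4" and q_eq: "q = a2 * u1 + a1 * u2"
    and u2: "u2 < a2" and u3: "u3 < a3" and u1: "u1 > 0" and u4: "u4 > 0 \<or> u3 = 0" and p: "p > 0"
begin

lemma q: "q > 0"
  using q_eq a_pos u1 by simp

lemma weight_split: "n 1 * x1 + n 2 * x2 + n 3 * x3 + n 4 * x4 = p * (a2 * x1 + a1 * x2) + q * (a4 * x3 + a3 * x4)"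
  by (simp add: n_eq algebra_simps)

text \<open>No other monomial has the weight of x2^u2, because u2 < a2 and u1 > 0 exclude every
  exchange.\<close>

lemma maximal_u2: "maximal n (exponents 0 u2 0 0)"
  unfolding maximal_exponents
proof (intro allI impI)
  fix x1 x2 x3 x4
  assume "n 1 * x1 + n 2 * x2 + n 3 * x3 + n 4 * x4 = n 1 * 0 + n 2 * u2 + n 3 * 0 + n 4 * 0"
  then have "p * (a1 * u2) + q * 0 = p * (a2 * x1 + a1 * x2) + q * (a4 * x3 + a3 * x4)"
    unfolding weight_split by simp
  from coprime_pq this p q show "x1 + x2 + x3 + x4 \<le> 0 + u2 + 0 + 0"
  proof (cases rule: coprime_exchange)
    case (down k)
    then have "a1 * u2 = a2 * (x1 + u1 * k) + a1 * (x2 + u2 * k)" by (simp add: q_eq algebra_simps)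
    then have *: "x1 + u1 * k = 0 \<and> x2 + u2 * k = u2" by (rule coprime_linear_eq[OF coprime12 _ u2 a_pos(1)])
    then have "k = 0" using u1 by simp
    then show ?thesis using * down(2) a_pos by simp
  next
    case (up k)
    then show ?thesis using p by simp
  qed
qed

text \<open>Again the monomial is alone in its weight. An exchange towards the first pair would need
  u4 = 0, which u3 > 0 forbids.\<close>

lemma maximal_u2_u3:
  assumes "u3 > 0" shows "maximal n (exponents 0 u2 (a3 - u3) 0)"
  unfolding maximal_exponents
proof (intro allI impI)
  fix x1 x2 x3 x4
  assume "n 1 * x1 + n 2 * x2 + n 3 * x3 + n 4 * x4 = n 1 * 0 + n 2 * u2 + n 3 * (a3 - u3) + n 4 * 0"
  then have "p * (a1 * u2) + q * (a4 * (a3 - u3)) = p * (a2 * x1 + a1 * x2) + q * (a4 * x3 + a3 * x4)"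
    unfolding weight_split by simp
  from coprime_pq this p q show "x1 + x2 + x3 + x4 \<le> 0 + u2 + (a3 - u3) + 0"
  proof (cases rule: coprime_exchange)
    case (down k)
    then have "a1 * u2 = a2 * (x1 + u1 * k) + a1 * (x2 + u2 * k)" by (simp add: q_eq algebra_simps)
    then have *: "x1 + u1 * k = 0 \<and> x2 + u2 * k = u2" by (rule coprime_linear_eq[OF coprime12 _ u2 a_pos(1)])
    then have k: "k = 0" using u1 by simp
    then have "a4 * (a3 - u3) = a3 * x4 + a4 * x3" using down(2) by simp
    then have "x4 = 0 \<and> x3 = a3 - u3"
      by (rule coprime_linear_eq[OF coprime34]) (use assms a_pos in auto)
    then show ?thesis using * k by simp
  next
    case (up k)
    then have "a4 * (a3 - u3) = a3 * (x4 + u4 * k) + a4 * (x3 + u3 * k)" by (simp add: p_eq algebra_simps)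
    then have "x4 + u4 * k = 0 \<and> x3 + u3 * k = a3 - u3"
      by (rule coprime_linear_eq[OF coprime34]) (use assms a_pos in auto)
    then show ?thesis using up(1) u4 assms by simp
  qed
qed

text \<open>Multiplying the two monomials above by x1^u1 keeps them maximal. The products share
  their weights with x3^u3 x4^u4 and with x4^(a4 + u4), whose degrees they must bound.\<close>

lemma degree_conditions_necessary:
  assumes P: "\<And>m. maximal n m \<Longrightarrow> maximal n (Poly_Mapping.single 1 1 + m)"
  shows "u3 + u4 \<le> u1 + u2" "u3 > 0 \<Longrightarrow> a4 + u4 + u3 \<le> u1 + u2 + a3"
proof -
  have P': "maximal n (exponents k b c d)" if "maximal n (exponents 0 b c d)" for k b c d
    using that by (induction k) (use P exponents_add[of 1] in force)+
  have "n 1 * 0 + n 2 * 0 + n 3 * u3 + n 4 * u4 = n 1 * u1 + n 2 * u2 + n 3 * 0 + n 4 * 0"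
    unfolding weight_split by (simp add: mult.commute flip: p_eq q_eq)
  then show "u3 + u4 \<le> u1 + u2"
    using P'[OF maximal_u2, of u1] unfolding maximal_exponents by fastforce
  assume u3': "u3 > 0"
  have "p + a4 * (a3 - u3) = a3 * (a4 + u4)" using u3 by (simp add: p_eq algebra_simps diff_mult_distrib2)
  then have "p * q + q * (a4 * (a3 - u3)) = q * (a3 * (a4 + u4))"
    by (metis distrib_left mult.commute)
  then have "n 1 * 0 + n 2 * 0 + n 3 * 0 + n 4 * (a4 + u4) = n 1 * u1 + n 2 * u2 + n 3 * (a3 - u3) + n 4 * 0"
    unfolding weight_split by (simp flip: q_eq)
  then have "0 + 0 + 0 + (a4 + u4) \<le> u1 + u2 + (a3 - u3) + 0"
    using P'[OF maximal_u2_u3[OF u3'], of u1] unfolding maximal_exponents by blast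
  then show "a4 + u4 + u3 \<le> u1 + u2 + a3" using u3 by simp
qed

text \<open>A monomial whose weight is also that of some multiple of x1 is rewritten as such a
  multiple without loss of degree. The rewriting uses the generators and the relation between x4^(a4
  + u4) and x1^u1 x2^u2 x3^(a3 - u3).\<close>

lemma raise_x1:
  assumes le: "a2 \<le> a1" "a3 \<le> a4"
    and deg: "u3 + u4 \<le> u1 + u2" "u3 > 0 \<Longrightarrow> a4 + u4 + u3 \<le> u1 + u2 + a3"
    and eq: "p * (a2 * x1 + a1 * x2) + q * (a4 * x3 + a3 * x4) =
      p * (a2 * Suc y1 + a1 * y2) + q * (a4 * y3 + a3 * y4)"
  shows "\<exists>z1 z2 z3 z4. p * (a2 * Suc z1 + a1 * z2) + q * (a4 * z3 + a3 * z4) =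
      p * (a2 * x1 + a1 * x2) + q * (a4 * x3 + a3 * x4) \<and> x1 + x2 + x3 + x4 \<le> Suc z1 + z2 + z3 + z4"
proof -
  \<comment> \<open>Trading x3^a3 for x4^a4 as often as possible does not lower the degree, as a3
    \<le> a4.\<close>
  define r s where "r = x3 mod a3" and "s = x4 + a4 * (x3 div a3)"
  have r: "r < a3" using a_pos by (simp add: r_def)
  have x3: "x3 = a3 * (x3 div a3) + r" by (simp add: r_def)
  have rs: "a4 * x3 + a3 * x4 = a4 * r + a3 * s"
    by (subst x3) (simp add: s_def algebra_simps)
  have "a3 * (x3 div a3) \<le> a4 * (x3 div a3)" using le(2) by simp
  then have rs_deg: "x3 + x4 \<le> r + s" using x3 s_def by linarith
  \<comment> \<open>The first four cases each permit a rewriting step; in the last one uniqueness of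
    representations contradicts \<open>eq\<close>.\<close>
  consider "x1 > 0" | "x2 \<ge> a2" | "u3 \<le> r" "u4 \<le> s" | "u3 > 0" "a4 + u4 \<le> s"
    | "x1 = 0" "x2 < a2" "\<not> (u3 \<le> r \<and> u4 \<le> s)" "\<not> (u3 > 0 \<and> a4 + u4 \<le> s)"
    by linarith
  then show ?thesis
  proof cases
    case 1
    then show ?thesis by (intro exI[of _ "x1 - 1"] exI[of _ x2] exI[of _ x3] exI[of _ x4]) simp
  next
    case 2
    then obtain x where x: "x2 = a2 + x" using le_Suc_ex by blast
    obtain b where b: "a1 = Suc b" using a_pos(1) gr0_implies_Suc by blast
    have "a2 * Suc (x1 + b) + a1 * x = a2 * x1 + a1 * x2" by (simp add: x b algebra_simps)
    then show ?thesis using x b le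
      by (intro exI[of _ "x1 + b"] exI[of _ x] exI[of _ x3] exI[of _ x4] conjI) simp_all
  next
    case 3
    obtain v where v: "u1 = Suc v" using u1 gr0_implies_Suc by blast
    obtain r' s' where r': "r = u3 + r'" "s = u4 + s'" using 3 le_Suc_ex by metis
    have 1: "a2 * Suc (x1 + v) + a1 * (x2 + u2) = (a2 * x1 + a1 * x2) + q" by (simp add: q_eq v algebra_simps)
    have 2: "a4 * x3 + a3 * x4 = p + (a4 * r' + a3 * s')" unfolding rs by (simp add: r' p_eq algebra_simps)
    have "p * (a2 * Suc (x1 + v) + a1 * (x2 + u2)) + q * (a4 * r' + a3 * s') =
        p * (a2 * x1 + a1 * x2) + q * (a4 * x3 + a3 * x4)"
      unfolding 1 2 by (simp add: distrib_left mult.commute)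
    moreover have "x1 + x2 + x3 + x4 \<le> Suc (x1 + v) + (x2 + u2) + r' + s'"
      using rs_deg deg(1) unfolding r' v by simp
    ultimately show ?thesis by blast
  next
    case 4
    obtain v where v: "u1 = Suc v" using u1 gr0_implies_Suc by blast
    obtain s' where s': "s = a4 + u4 + s'" using 4 le_Suc_ex by metis
    obtain t where t: "a3 = u3 + t" using u3 by (metis le_Suc_ex less_imp_le)
    have 1: "a2 * Suc (x1 + v) + a1 * (x2 + u2) = (a2 * x1 + a1 * x2) + q" by (simp add: q_eq v algebra_simps)
    have 2: "a4 * x3 + a3 * x4 = p + (a4 * (r + t) + a3 * s')"
      unfolding rs by (simp add: s' p_eq t algebra_simps)
    have "p * (a2 * Suc (x1 + v) + a1 * (x2 + u2)) + q * (a4 * (r + t) + a3 * s') =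
        p * (a2 * x1 + a1 * x2) + q * (a4 * x3 + a3 * x4)"
      unfolding 1 2 by (simp add: distrib_left mult.commute)
    moreover have "x1 + x2 + x3 + x4 \<le> Suc (x1 + v) + (x2 + u2) + (r + t) + s'"
      using rs_deg deg(2)[OF 4(1)] unfolding s' v t by simp
    ultimately show ?thesis by blast
  next
    case 5
    have "p * (a1 * x2) + q * (a4 * r + a3 * s) = p * (a2 * Suc y1 + a1 * y2) + q * (a4 * y3 + a3 * y4)"
      using eq 5(1) rs by simp
    from coprime_pq this p q have False
    proof (cases rule: coprime_exchange)
      case (down k)
      then have "a1 * x2 = a2 * (Suc y1 + u1 * k) + a1 * (y2 + u2 * k)" by (simp add: q_eq algebra_simps)
      then have "Suc y1 + u1 * k = 0 \<and> y2 + u2 * k = x2"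
        by (rule coprime_linear_eq[OF coprime12 _ 5(2) a_pos(1)])
      then show False by simp
    next
      case (up k)
      obtain j where j: "k = Suc j" using up(1) gr0_implies_Suc by blast
      \<comment> \<open>One copy of (u3, u4) is split off from the \<open>k\<close> copies and the
        rest is reduced modulo x3^a3 = x4^a4. Adding the copy back either stays below a3 or wraps
        around once, which are the two excluded situations.\<close>
      define e3 e4 where "e3 = y3 + u3 * j" and "e4 = y4 + u4 * j"
      define r' s' where "r' = e3 mod a3" and "s' = e4 + a4 * (e3 div a3)"
      have r': "r' < a3" using a_pos by (simp add: r'_def)
      have e3: "e3 = a3 * (e3 div a3) + r'" by (simp add: r'_def)
      have "a4 * r + a3 * s = a4 * (u3 + e3) + a3 * (u4 + e4)"
        using up(3) by (simp add: p_eq j e3_def e4_def algebra_simps)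
      also have "\<dots> = a4 * (u3 + r') + a3 * (u4 + s')"
        by (subst e3) (simp add: s'_def algebra_simps)
      finally have B: "a4 * r + a3 * s = a4 * (u3 + r') + a3 * (u4 + s')" .
      show False
      proof (cases "u3 + r' < a3")
        case True
        then have "r = u3 + r' \<and> s = u4 + s'" using coprime_linear_eq'[OF coprime34 B r] a_pos by blast
        then show False using 5(3) by simp
      next
        case False
        then obtain t where t: "u3 + r' = a3 + t" by (metis le_Suc_ex not_less)
        then have "t < a3" using r' u3 by simp
        moreover have "a4 * r + a3 * s = a4 * t + a3 * (a4 + u4 + s')"
          unfolding B t by (simp add: algebra_simps)
        ultimately have "r = t \<and> s = a4 + u4 + s'" using coprime_linear_eq'[OF coprime34 _ r] a_pos by blast
        then show False using 5(4) r' False by simp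
      qed
    qed
    then show ?thesis ..
  qed
qed

text \<open>After \<open>raise_x1\<close> a competitor of x1 times \<open>m\<close> is itself
  divisible by x1; cancelling x1 leaves a competitor of \<open>m\<close>.\<close>

lemma degree_conditions_sufficient:
  assumes le: "a2 \<le> a1" "a3 \<le> a4"
    and deg: "u3 + u4 \<le> u1 + u2" "u3 > 0 \<Longrightarrow> a4 + u4 + u3 \<le> u1 + u2 + a3"
    and m: "maximal n m"
  shows "maximal n (Poly_Mapping.single 1 1 + m)"
proof -
  obtain y1 y2 y3 y4 where y: "m = exponents y1 y2 y3 y4" using exponents_exhaust by blast
  show ?thesis
    unfolding y exponents_add maximal_exponents
  proof (intro allI impI)
    fix x1 x2 x3 x4
    assume "n 1 * x1 + n 2 * x2 + n 3 * x3 + n 4 * x4 = n 1 * (1 + y1) + n 2 * y2 + n 3 * y3 + n 4 * y4"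
    then have eq: "p * (a2 * x1 + a1 * x2) + q * (a4 * x3 + a3 * x4) =
        p * (a2 * Suc y1 + a1 * y2) + q * (a4 * y3 + a3 * y4)"
      unfolding weight_split by simp
    obtain z1 z2 z3 z4 where
      z: "p * (a2 * Suc z1 + a1 * z2) + q * (a4 * z3 + a3 * z4) = p * (a2 * x1 + a1 * x2) + q * (a4 * x3 + a3 * x4)"
      "x1 + x2 + x3 + x4 \<le> Suc z1 + z2 + z3 + z4"
      using raise_x1[OF le deg eq] by blast
    have "n 1 * z1 + n 2 * z2 + n 3 * z3 + n 4 * z4 = n 1 * y1 + n 2 * y2 + n 3 * y3 + n 4 * y4"
      using z(1) eq unfolding weight_split by (simp add: algebra_simps)
    then have "z1 + z2 + z3 + z4 \<le> y1 + y2 + y3 + y4" using m unfolding y maximal_exponents by blast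
    then show "x1 + x2 + x3 + x4 \<le> 1 + y1 + y2 + y3 + y4" using z(2) by simp
  qed
qed

end

section \<open>Recovering the gluing data from the generators\<close>

lemma binomial_in_toric_ideal_iff:
  "(mon m - mon m' :: ('v :: finite, 'k :: field) mpoly) \<in> toric_ideal n \<longleftrightarrow> weight n m = weight n m'"
proof
  assume "(mon m - mon m' :: ('v, 'k) mpoly) \<in> toric_ideal n"
  then have "coeff (curve_map n (mon m - mon m' :: ('v, 'k) mpoly)) (weight n m) = 0"
    by (simp add: toric_ideal_def)
  then show "weight n m = weight n m'"
    by (auto simp: coeff_curve_map coeff_sum_minus coeff_sum_single split: if_splits)
qed (rule binomial_in_toric_ideal)

lemma curve_map_mon: "curve_map n (mon m) = Polynomial.monom 1 (weight n m)"
  by (rule poly_eqI) (simp add: coeff_curve_map coeff_sum_single)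

lemma curve_map_diff: "curve_map n (f - g) = curve_map n f - curve_map n g"
  using curve_map_add[of n "f - g" g] by simp

text \<open>Modulo t^M - 1 the variable t is invertible: t^(j(M-1)) times t^j is (t^M)^j, which is
  congruent to 1.\<close>

lemma monom_minus_1_dvd_cancel:
  fixes h :: "'k :: field poly"
  assumes M: "M > 0" and dvd: "(Polynomial.monom 1 M - 1) dvd Polynomial.monom 1 j * h"
  shows "(Polynomial.monom 1 M - 1) dvd h"
proof -
  have "Polynomial.monom (1 :: 'k) (j * (M - 1)) * Polynomial.monom 1 j = Polynomial.monom 1 M ^ j"
    using M by (cases M) (simp_all add: mult_monom monom_power algebra_simps)
  then have "(Polynomial.monom 1 M - 1) dvd Polynomial.monom 1 M ^ j * h"
    using dvd_mult[OF dvd, of "Polynomial.monom 1 (j * (M - 1))"] by (simp add: mult.assoc[symmetric])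
  moreover have "(Polynomial.monom 1 M - 1) dvd (Polynomial.monom (1 :: 'k) M ^ j - 1 ^ j)"
    by (simp only: power_diff_sumr2 dvd_triv_left)
  then have "(Polynomial.monom 1 M - 1) dvd (Polynomial.monom 1 M ^ j - 1) * h"
    by (metis dvd_mult2 power_one)
  ultimately have "(Polynomial.monom 1 M - 1) dvd Polynomial.monom 1 M ^ j * h - (Polynomial.monom 1 M ^ j - 1) * h"
    by (rule dvd_diff)
  then show ?thesis by (simp add: algebra_simps)
qed

text \<open>The multiple n_j n_i is admissible, so the minimum is attained.\<close>

lemma least_multiple_pos:
  fixes n :: "'v :: finite \<Rightarrow> nat"
  assumes pos: "\<And>i. n i > 0" and j: "j \<noteq> i"
  shows "least_multiple n i > 0"
proof -
  have "n j * n i = (\<Sum>k\<in>UNIV - {i}. (if k = j then n i else 0) * n k)"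
    using j by (simp add: if_distrib[of "\<lambda>x. x * _"] cong: if_cong)
  then have "n j > 0 \<and> (\<exists>c :: 'v \<Rightarrow> nat. n j * n i = (\<Sum>k\<in>UNIV - {i}. c k * n k))"
    using pos[of j] by (intro conjI exI[of _ "\<lambda>k. if k = j then n i else 0"])
  from LeastI[of "\<lambda>b. b > 0 \<and> (\<exists>c :: 'v \<Rightarrow> nat. b * n i = (\<Sum>k\<in>UNIV - {i}. c k * n k))", OF this]
  show ?thesis unfolding least_multiple_def by blast
qed

lemma least_multiple_le:
  fixes c :: "'v :: finite \<Rightarrow> nat"
  assumes "b > 0" "b * n i = (\<Sum>k\<in>UNIV - {i}. c k * n k)"
  shows "least_multiple n i \<le> b"
  unfolding least_multiple_def by (rule Least_le) (use assms in blast)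

text \<open>Dividing the relation by a common factor would give a smaller admissible
  multiple.\<close>

lemma coprime_least_multiple:
  fixes n :: "'v :: finite \<Rightarrow> nat"
  assumes pos: "\<And>i. n i > 0" and ij: "i \<noteq> j"
    and eq: "n i * least_multiple n i = n j * b"
  shows "coprime (least_multiple n i) b"
proof -
  define g where "g = gcd (least_multiple n i) b"
  obtain x y where x: "least_multiple n i = g * x" and y: "b = g * y"
    unfolding g_def by (meson dvdE gcd_dvd1 gcd_dvd2)
  have lp: "least_multiple n i > 0" using least_multiple_pos[OF pos, of j i] ij by simp
  then have g: "g > 0" and xp: "x > 0" using x by (auto intro: Nat.gr0I)
  have "g * (n i * x) = g * (n j * y)" using eq by (simp add: x y ac_simps)
  then have "x * n i = y * n j" using g by (simp add: ac_simps)
  then have "x * n i = (\<Sum>k\<in>UNIV - {i}. (if k = j then y else 0) * n k)"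
    using ij by (simp add: if_distrib[of "\<lambda>x. x * _"] cong: if_cong)
  then have "g * x \<le> x" using least_multiple_le[where i = i and n = n, OF xp] x by simp
  then have "g = 1" using g xp by simp
  then show ?thesis by (simp add: g_def coprime_iff_gcd_eq_1)
qed

lemma range_4: "range f = {f 1, f 2, f 3, f (4 :: 4)}"
  unfolding UNIV_4 by simp

text \<open>
  Every element of the ideal vanishes modulo \<open>t ^ (a2 u1 + a1 u2) - 1\<close> under
  \<open>x\<^sub>1 \<mapsto> t ^ a2\<close>, \<open>x\<^sub>2 \<mapsto> t ^ a1\<close>, \<open>x\<^sub>3, x\<^sub>4 \<mapsto> 1\<close>; testing this on a binomial whose image is
  \<open>t ^ j (t ^ q - 1)\<close> bounds the exponent by \<open>q\<close>.
\<close>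

lemma gluing_exponent_le:
  fixes n :: "4 \<Rightarrow> nat"
  assumes toric: "(toric_ideal n :: (4, 'k :: field) mpoly set) = Idl\<^bsub>mpoly_ring\<^esub>
      {var 1 ^ a1 - var 2 ^ a2, var 3 ^ a3 - var 4 ^ a4, var 1 ^ u1 * var 2 ^ u2 - var 3 ^ u3 * var 4 ^ u4}"
    and n: "n 1 = a2 * p" "n 2 = a1 * p" "n 3 = a4 * q" "n 4 = a3 * q"
    and pos: "a2 > 0" "a4 > 0" "q > 0"
    and coprime: "coprime a2 a1" "coprime a4 a3"
  shows "0 < a2 * u1 + a1 * u2" "a2 * u1 + a1 * u2 \<le> q"
proof -
  define M where "M = a2 * u1 + a1 * u2"
  define e :: "4 \<Rightarrow> nat" where "e = (\<lambda>_. 0)(1 := a2, 2 := a1)"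
  have e: "e 1 = a2" "e 2 = a1" "e 3 = 0" "e 4 = 0" by (simp_all add: e_def)
  let ?T = "Polynomial.monom 1 M - 1 :: 'k poly"
  let ?I = "{f :: (4, 'k) mpoly. ?T dvd curve_map e f}"
  have "ideal ?I mpoly_ring"
    unfolding mpoly_ideal_iff by (auto simp: curve_map_add curve_map_mult curve_map_def[of e 0])
  moreover have "{var 1 ^ a1 - var 2 ^ a2, var 3 ^ a3 - var 4 ^ a4, var 1 ^ u1 * var 2 ^ u2 - var 3 ^ u3 * var 4 ^ u4} \<subseteq> ?I"
    by (simp add: curve_map_diff var_power mult_single curve_map_mon weight_add e M_def mult.commute monom_0 flip: one_pCons)
  ultimately have sub: "toric_ideal n \<subseteq> ?I"
    unfolding toric by (rule ring.genideal_minimal[OF cring.axioms(1)[OF cring_mpoly_ring]])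
  obtain x y where xy: "a2 * x = a1 * y + 1" using bezout_nat[of a2 a1] pos coprime by auto
  obtain z w where zw: "a4 * z = a3 * w + 1" using bezout_nat[of a4 a3] pos coprime by auto
  \<comment> \<open>By the Bezout relations the two halves of the exponents differ in weight by p q
    in opposite directions, so the total weights agree.\<close>
  let ?m = "exponents (q * x) 0 0 (p * w)" and ?m' = "exponents 0 (q * y) (p * z) 0"
  have "weight n ?m = p * q * (a2 * x) + p * q * (a3 * w)" "weight n ?m' = p * q * (a1 * y) + p * q * (a4 * z)"
    by (simp_all add: weight_exponents n)
  then have "weight n ?m = weight n ?m'" unfolding xy zw by (simp add: algebra_simps)
  then have "(mon ?m - mon ?m' :: (4, 'k) mpoly) \<in> ?I"
    using sub binomial_in_toric_ideal by blast
  then have "?T dvd Polynomial.monom 1 (q * (a2 * x)) - Polynomial.monom 1 (q * (a1 * y))"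
    by (simp add: curve_map_diff curve_map_mon weight_exponents e ac_simps)
  moreover have "Polynomial.monom (1 :: 'k) (q * (a2 * x)) - Polynomial.monom 1 (q * (a1 * y))
      = Polynomial.monom 1 (q * (a1 * y)) * (Polynomial.monom 1 q - 1)"
    unfolding xy by (simp add: right_diff_distrib mult_monom add.commute)
  ultimately have dvd: "?T dvd Polynomial.monom 1 (q * (a1 * y)) * (Polynomial.monom 1 q - 1)" by simp
  have deg: "degree (Polynomial.monom 1 k - 1 :: 'k poly) = k" for k
  proof (cases "k = 0")
    case False
    have "degree (Polynomial.monom 1 k + (- 1) :: 'k poly) = degree (Polynomial.monom 1 k :: 'k poly)"
      by (rule degree_add_eq_left) (use False in \<open>simp add: degree_monom_eq\<close>)
    then show ?thesis by (simp add: degree_monom_eq)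
  qed (simp add: monom_0 flip: one_pCons)
  have nz: "Polynomial.monom 1 q - 1 \<noteq> (0 :: 'k poly)" using deg[of q] pos by auto
  show "0 < a2 * u1 + a1 * u2"
  proof (rule ccontr)
    assume "\<not> 0 < a2 * u1 + a1 * u2"
    \<comment> \<open>Then the modulus is zero, but it divides the image of the test binomial, which
      is nonzero.\<close>
    then have "M = 0" by (simp only: M_def not_gr_zero)
    then have "?T = 0" by (simp add: monom_0 flip: one_pCons)
    then show False using dvd nz by (simp add: monom_eq_0_iff)
  qed
  then have "M > 0" by (simp only: M_def)
  then have "?T dvd Polynomial.monom 1 q - 1" using dvd by (rule monom_minus_1_dvd_cancel)
  then have "degree ?T \<le> degree (Polynomial.monom 1 q - 1 :: 'k poly)" using nz by (rule dvd_imp_degree_le)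
  then show "a2 * u1 + a1 * u2 \<le> q" unfolding deg M_def .
qed

lemma Gcd_range_4_coprime:
  fixes n :: "4 \<Rightarrow> nat"
  assumes "Gcd (range n) = 1" "n 1 = a2 * p" "n 2 = a1 * p" "n 3 = a4 * q" "n 4 = a3 * q"
  shows "coprime p q"
proof (rule coprimeI)
  fix c assume "c dvd p" "c dvd q"
  then have "c dvd Gcd (range n)" by (intro Gcd_greatest) (auto simp: range_4 assms)
  then show "is_unit c" by (simp add: assms(1))
qed

section \<open>Shifting the gluing along the vector \<open>d\<close>\<close>

theorem theorem2p8:
  fixes n a u d :: "4 \<Rightarrow> nat"
  assumes "\<And>i. n i > 0"
    and "Gcd (range n) = 1"
    and "\<And>i. a i = least_multiple n i"
    and "complete_intersection (toric_ideal n :: (4, 'k :: field) mpoly set)"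
    and "(toric_ideal n :: (4, 'k) mpoly set) =
           Idl\<^bsub>mpoly_ring\<^esub>
             {var 1 ^ a 1 - var 2 ^ a 2,
              var 3 ^ a 3 - var 4 ^ a 4,
              var 1 ^ u 1 * var 2 ^ u 2 - var 3 ^ u 3 * var 4 ^ u 4}"
    and "n 1 = Min (range n)"
    and "a 3 < a 4"
    and "d 1 = a 2 * a 3" and "d 2 = a 1 * a 3" and "d 3 = a 2 * a 4" and "d 4 = a 2 * a 3"
    and "cm_tangent_cone TYPE('k) n"
  shows "\<forall>w :: nat. w > 0 \<longrightarrow> Gcd (range (\<lambda>i. n i + w * d i)) = 1 \<longrightarrow>
           cm_tangent_cone TYPE('k) (\<lambda>i. n i + w * d i)"
proof (intro allI impI)
  fix w :: nat assume "w > 0" and gcd_w: "Gcd (range (\<lambda>i. n i + w * d i)) = 1"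
  note pos = assms(1) and least = assms(3) and toric = assms(5)
  let ?G = "{var 1 ^ a 1 - var 2 ^ a 2, var 3 ^ a 3 - var 4 ^ a 4,
      var 1 ^ u 1 * var 2 ^ u 2 - var 3 ^ u 3 * var 4 ^ u 4} :: (4, 'k) mpoly set"
  have "?G \<subseteq> toric_ideal n"
    unfolding toric by (rule ring.genideal_self[OF cring.axioms(1)[OF cring_mpoly_ring]]) simp
  then have eq12: "n 1 * a 1 = n 2 * a 2" and eq34: "n 3 * a 3 = n 4 * a 4"
    and equ: "n 1 * u 1 + n 2 * u 2 = n 3 * u 3 + n 4 * u 4"
    by (simp_all add: var_power mult_single binomial_in_toric_ideal_iff weight_add)
  have a_pos: "a i > 0" for i
  proof -
    obtain j :: 4 where "j \<noteq> i" by (cases "i = 1") (use that[of 2] that[of 1] in auto)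
    then show ?thesis using least_multiple_pos[OF pos] least by simp
  qed
  have co12: "coprime (a 1) (a 2)"
    using coprime_least_multiple[where n = n and i = 1 and j = 2 and b = "a 2", OF pos] eq12 least[of 1] by simp
  have co34: "coprime (a 3) (a 4)"
    using coprime_least_multiple[where n = n and i = 3 and j = 4 and b = "a 4", OF pos] eq34 least[of 3] by simp
  have "a 2 dvd n 1 * a 1" by (simp add: eq12)
  then have "a 2 dvd n 1" using co12 by (simp add: coprime_commute coprime_dvd_mult_left_iff)
  then obtain p where p: "n 1 = a 2 * p" by (elim dvdE)
  have "a 2 * n 2 = a 2 * (a 1 * p)" using eq12 p by (metis mult.assoc mult.commute)
  then have p': "n 2 = a 1 * p" using a_pos[of 2] by simp
  have "a 4 dvd n 3 * a 3" by (simp add: eq34)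
  then have "a 4 dvd n 3" using co34 by (simp add: coprime_commute coprime_dvd_mult_left_iff)
  then obtain q where q: "n 3 = a 4 * q" by (elim dvdE)
  have "a 4 * n 4 = a 4 * (a 3 * q)" using eq34 q by (metis mult.assoc mult.commute)
  then have q': "n 4 = a 3 * q" using a_pos[of 4] by simp
  have p_pos: "p > 0" and q_pos: "q > 0" using pos[of 1] pos[of 3] by (simp_all add: p q)
  have co_pq: "coprime p q" using Gcd_range_4_coprime[OF assms(2) p p' q q'] .
  have M: "0 < a 2 * u 1 + a 1 * u 2" "a 2 * u 1 + a 1 * u 2 \<le> q"
    using gluing_exponent_le[OF toric p p' q q'] a_pos q_pos co12 co34 by (simp_all add: coprime_commute)
  have pq: "p * (a 2 * u 1 + a 1 * u 2) = q * (a 4 * u 3 + a 3 * u 4)"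
    using equ by (simp add: p p' q q' algebra_simps)
  then have "q dvd p * (a 2 * u 1 + a 1 * u 2)" by simp
  then have "q dvd a 2 * u 1 + a 1 * u 2" using co_pq by (simp add: coprime_commute coprime_dvd_mult_right_iff)
  \<comment> \<open>Divisibility by \<open>q\<close>, positivity and the upper bound
    \<open>q\<close> leave only equality.\<close>
  then have q_u: "q = a 2 * u 1 + a 1 * u 2" using M by (simp add: dvd_imp_le le_antisym)
  then have "q * p = q * (a 4 * u 3 + a 3 * u 4)" using pq by (metis mult.commute)
  then have p_u: "p = a 4 * u 3 + a 3 * u 4" using q_pos by (simp only: mult_cancel1) simp
  \<comment> \<open>Trading x2^a2 for x1^a1 and x3^a3 for x4^a4 normalises the exponents while
    preserving the formulas for \<open>p\<close> and \<open>q\<close>.\<close>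
  define v1 v2 v3 v4 where v: "v1 = u 1 + a 1 * (u 2 div a 2)" "v2 = u 2 mod a 2"
    "v3 = u 3 mod a 3" "v4 = u 4 + a 4 * (u 3 div a 3)"
  have "a 1 * u 2 = a 1 * (a 2 * (u 2 div a 2) + v2)" "a 4 * u 3 = a 4 * (a 3 * (u 3 div a 3) + v3)"
    by (simp_all add: v)
  then have q_v: "q = a 2 * v1 + a 1 * v2" and p_v: "p = a 4 * v3 + a 3 * v4"
    unfolding q_u p_u v(1,4) by (simp_all add: algebra_simps)
  have v2: "v2 < a 2" and v3: "v3 < a 3" using a_pos by (simp_all add: v)
  have rel: "n 1 * v1 + n 2 * v2 = n 3 * v3 + n 4 * v4"
  proof -
    have "n 1 * v1 + n 2 * v2 = p * (a 2 * v1 + a 1 * v2)" by (simp add: p p' algebra_simps)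
    also have "\<dots> = q * (a 4 * v3 + a 3 * v4)" by (simp flip: q_v p_v)
    also have "\<dots> = n 3 * v3 + n 4 * v4" by (simp add: q q' algebra_simps)
    finally show ?thesis .
  qed
  have U2: "UNIV - {2 :: 4} = {1, 3, 4}" and U3: "UNIV - {3 :: 4} = {1, 2, 4}"
    unfolding UNIV_4 by auto
  \<comment> \<open>Otherwise v2 n_2 is a combination of n_3 and n_4 with 0 < v2 < a_2, against the
    minimality of a_2. The claim on \<open>v4\<close> follows likewise from a_3.\<close>
  have v1: "v1 > 0"
  proof (rule ccontr)
    assume "\<not> v1 > 0"
    then have v1: "v1 = 0" by simp
    then have "v2 > 0" using q_v q_pos by (auto intro: Nat.gr0I)
    moreover have "v2 * n 2 = (\<Sum>k\<in>UNIV - {2}. ((\<lambda>_. 0)(3 := v3, 4 := v4)) k * n k)"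
      unfolding U2 using rel v1 by (simp add: mult.commute)
    ultimately have "a 2 \<le> v2" unfolding least by (rule least_multiple_le)
    then show False using v2 by simp
  qed
  have v4: "v4 > 0 \<or> v3 = 0"
  proof (rule ccontr)
    assume "\<not> (v4 > 0 \<or> v3 = 0)"
    then have v4: "v4 = 0" and "v3 > 0" by auto
    note \<open>v3 > 0\<close>
    moreover have "v3 * n 3 = (\<Sum>k\<in>UNIV - {3}. ((\<lambda>_. 0)(1 := v1, 2 := v2)) k * n k)"
      unfolding U3 using rel v4 by (simp add: mult.commute)
    ultimately have "a 3 \<le> v3" unfolding least by (rule least_multiple_le)
    then show False using v3 by simp
  qed
  have min: "n 1 \<le> n i" for i by (simp add: assms(6))
  have a21: "a 2 \<le> a 1" using min[of 2] p_pos by (simp add: p p')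
  interpret old: gluing n "a 1" "a 2" "a 3" "a 4" v1 v2 v3 v4 p q
    by unfold_locales (use a_pos co12 co34 co_pq p p' q q' p_v q_v v1 v2 v3 v4 p_pos in \<open>simp_all add: coprime_commute\<close>)
  interpret old_curve: monomial_curve n 1
    by unfold_locales (use pos min in auto)
  have deg: "v3 + v4 \<le> v1 + v2" "v3 > 0 \<Longrightarrow> a 4 + v4 + v3 \<le> v1 + v2 + a 3"
    using old.degree_conditions_necessary old_curve.cm_tangent_cone_iff[where 'k = 'k] assms(12) by blast+
  \<comment> \<open>The shifted weights have the same gluing shape: \<open>p\<close> grows by w a_3
    and \<open>q\<close> by w a_2, which amounts to raising \<open>v4\<close> and \<open>v1\<close>
    by \<open>w\<close>.\<close>
  let ?n = "\<lambda>i. n i + w * d i" and ?p = "p + w * a 3" and ?q = "q + w * a 2"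
  have n': "?n 1 = a 2 * ?p" "?n 2 = a 1 * ?p" "?n 3 = a 4 * ?q" "?n 4 = a 3 * ?q"
    by (simp_all add: assms(8-11) p p' q q' algebra_simps)
  interpret new: gluing ?n "a 1" "a 2" "a 3" "a 4" "v1 + w" v2 v3 "v4 + w" ?p ?q
  proof unfold_locales
    show "coprime ?p ?q" using Gcd_range_4_coprime[OF gcd_w n'] .
    show "?p = a 4 * v3 + a 3 * (v4 + w)" "?q = a 2 * (v1 + w) + a 1 * v2"
      by (simp_all add: p_v q_v algebra_simps)
  qed (use n' a_pos co12 co34 v1 v2 v3 v4 p_pos \<open>w > 0\<close> in \<open>simp_all add: coprime_commute\<close>)
  interpret new_curve: monomial_curve ?n 1
  proof unfold_locales
    show "?n i > 0" for i using pos[of i] by simp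
    have le2: "?n 1 \<le> ?n 2" unfolding n' using a21 by simp
    \<comment> \<open>As d_1 = d_4, the inequality between n_1 and n_4 persists; a_3 < a_4 then
      handles the third entry.\<close>
    have le4: "?n 1 \<le> ?n 4" using min[of 4] by (simp add: assms(8,11))
    also have "?n 4 \<le> ?n 3" unfolding n' using assms(7) by simp
    finally have le3: "?n 1 \<le> ?n 3" .
    show "?n 1 \<le> ?n i" for i
    proof -
      have "i = 1 \<or> i = 2 \<or> i = 3 \<or> i = 4" using UNIV_4 by blast
      then show ?thesis by (elim disjE) (use le2 le3 le4 in \<open>simp_all only: order_refl\<close>)
    qed
  qed
  show "cm_tangent_cone TYPE('k) ?n"
    unfolding new_curve.cm_tangent_cone_iff
  proof (intro allI impI)
    fix m assume "maximal ?n m"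
    then show "maximal ?n (Poly_Mapping.single 1 1 + m)"
      \<comment> \<open>Both degree inequalities gain \<open>w\<close> on each side, so those for
        the old curve suffice.\<close>
      by (rule new.degree_conditions_sufficient[rotated -1]) (use a21 assms(7) deg in auto)
  qed
qed

end
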